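(* Let $k$ be a field, let $X\subseteq k$ be a subset, and let $A$ be a finite-dimensional associative unital $k$-algebra. (i) For any two parameters $p,q\in k$, the function $R:X\times X\to \mathrm{End}_k(A\otimes A)$ defined by $$R(u,v)(a\otimes b)=p(u-v)\,1\otimes ab+q(u-v)\,ab\otimes 1-(pu-qv)\,b\otimes a \qquad (a,b\in A)$$ is a coloured Yang-Baxter operator. (ii) Let $p,q\in k$ and $u,v\in X$. If $pu\neq qv$ and $qu\neq pv$, then the operator $R(u,v)$ defined in (i) is invertible, and for all $a,b\in A$ $$R^{-1}(u,v)(a\otimes b)=\frac{p(u-v)}{(qu-pv)(pu-qv)}\,ba\otimes 1+\frac{q(u-v)}{(qu-pv)(pu-qv)}\,1\otimes ba-\frac{1}{pu-qv}\,b\otimes a .$$ Here $R^{-1}(u,v)$ denotes the inverse of the linear operator $R(u,v)$.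
   Context: All tensor products are over $k$. For a finite-dimensional $k$-vector space $V$ and a set $X$, a function $R:X\times X\to \mathrm{End}_k(V\otimes V)$ is called a coloured Yang-Baxter operator if it satisfies the two-parameter quantum Yang-Baxter equation $$R_{12}(u,v)R_{13}(u,w)R_{23}(v,w)=R_{23}(v,w)R_{13}(u,w)R_{12}(u,v)\quad\text{for all }u,v,w\in X,$$ as operators on $V\otimes V\otimes V$, where $R_{12}(u,v)=R(u,v)\otimes \mathrm{id}_V$, $R_{23}(v,w)=\mathrm{id}_V\otimes R(v,w)$, and $R_{13}(u,w)$ is the operator acting as $R(u,w)$ on the first and third tensor factors and trivially on the second. *)

theory Defs
  imports "HOL-Algebra.AbelCoset" "Jordan_Normal_Form.Missing_VectorSpace"
begin

section \<open>Finite-dimensional associative unital algebras over a field\<close>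

text \<open>
  The record \<^type>\<open>module\<close> carries both the ring and the module operations.
  The locale \<^locale>\<open>algebra\<close> of HOL-Algebra requires a commutative multiplication and is therefore
  not usable here. The zero algebra is not excluded.
\<close>

locale fd_algebra = vectorspace K A + A: ring A for K (structure) and A (structure) +
  assumes smult_mult_left:
      "\<lbrakk>c \<in> carrier K; x \<in> carrier A; y \<in> carrier A\<rbrakk>
        \<Longrightarrow> (c \<odot>\<^bsub>A\<^esub> x) \<otimes>\<^bsub>A\<^esub> y = c \<odot>\<^bsub>A\<^esub> (x \<otimes>\<^bsub>A\<^esub> y)"
    and smult_mult_right:
      "\<lbrakk>c \<in> carrier K; x \<in> carrier A; y \<in> carrier A\<rbrakk>
        \<Longrightarrow> x \<otimes>\<^bsub>A\<^esub> (c \<odot>\<^bsub>A\<^esub> y) = c \<odot>\<^bsub>A\<^esub> (x \<otimes>\<^bsub>A\<^esub> y)"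
    and finite_dimensional: "fin_dim"


section \<open>Free modules, quotient modules and tensor products\<close>

text \<open>
  The fields \<open>mult\<close> and \<open>one\<close> of the module records below have no meaning and are left undefined.
\<close>

definition free_module :: "('k, 'r) ring_scheme \<Rightarrow> 's set \<Rightarrow> ('k, 's \<Rightarrow> 'k) module" where
  "free_module K S =
    \<lparr>carrier = {f. (\<forall>s. f s \<in> carrier K) \<and> finite {s. f s \<noteq> \<zero>\<^bsub>K\<^esub>} \<and> {s. f s \<noteq> \<zero>\<^bsub>K\<^esub>} \<subseteq> S},
     mult = undefined,
     one = undefined,
     zero = (\<lambda>_. \<zero>\<^bsub>K\<^esub>),
     add = (\<lambda>f g s. f s \<oplus>\<^bsub>K\<^esub> g s),
     smult = (\<lambda>c f s. c \<otimes>\<^bsub>K\<^esub> f s)\<rparr>"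

definition free_gen :: "('k, 'r) ring_scheme \<Rightarrow> 's \<Rightarrow> 's \<Rightarrow> 'k" where
  "free_gen K s = (\<lambda>t. if t = s then \<one>\<^bsub>K\<^esub> else \<zero>\<^bsub>K\<^esub>)"

definition quotient_module :: "('k, 'm, 'x) module_scheme \<Rightarrow> 'm set \<Rightarrow> ('k, 'm set) module" where
  "quotient_module M N =
    \<lparr>carrier = a_rcosets\<^bsub>M\<^esub> N,
     mult = undefined,
     one = undefined,
     zero = N,
     add = set_add M,
     smult = (\<lambda>c C. \<Union>x\<in>C. N +>\<^bsub>M\<^esub> (c \<odot>\<^bsub>M\<^esub> x))\<rparr>"

definition bilinear_relations ::
  "('k, 'r) ring_scheme \<Rightarrow> ('k, 'm, 'x) module_scheme \<Rightarrow> ('k, 'n, 'y) module_scheme \<Rightarrow> ('m \<times> 'n \<Rightarrow> 'k) set"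
  where
  "bilinear_relations K M N =
    (let F = free_module K (carrier M \<times> carrier N); e = (\<lambda>m n. free_gen K (m, n)) in
      {e (m \<oplus>\<^bsub>M\<^esub> m') n \<ominus>\<^bsub>F\<^esub> (e m n \<oplus>\<^bsub>F\<^esub> e m' n) | m m' n.
         m \<in> carrier M \<and> m' \<in> carrier M \<and> n \<in> carrier N} \<union>
      {e m (n \<oplus>\<^bsub>N\<^esub> n') \<ominus>\<^bsub>F\<^esub> (e m n \<oplus>\<^bsub>F\<^esub> e m n') | m n n'.
         m \<in> carrier M \<and> n \<in> carrier N \<and> n' \<in> carrier N} \<union>
      {e (c \<odot>\<^bsub>M\<^esub> m) n \<ominus>\<^bsub>F\<^esub> c \<odot>\<^bsub>F\<^esub> e m n | c m n.
         c \<in> carrier K \<and> m \<in> carrier M \<and> n \<in> carrier N} \<union>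
      {e m (c \<odot>\<^bsub>N\<^esub> n) \<ominus>\<^bsub>F\<^esub> c \<odot>\<^bsub>F\<^esub> e m n | c m n.
         c \<in> carrier K \<and> m \<in> carrier M \<and> n \<in> carrier N})"

definition tensor_kernel ::
  "('k, 'r) ring_scheme \<Rightarrow> ('k, 'm, 'x) module_scheme \<Rightarrow> ('k, 'n, 'y) module_scheme \<Rightarrow> ('m \<times> 'n \<Rightarrow> 'k) set"
  where
  "tensor_kernel K M N =
    LinearCombinations.module.span K (free_module K (carrier M \<times> carrier N)) (bilinear_relations K M N)"

definition tensor_product ::
  "('k, 'r) ring_scheme \<Rightarrow> ('k, 'm, 'x) module_scheme \<Rightarrow> ('k, 'n, 'y) module_scheme
    \<Rightarrow> ('k, ('m \<times> 'n \<Rightarrow> 'k) set) module" where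
  "tensor_product K M N =
    quotient_module (free_module K (carrier M \<times> carrier N)) (tensor_kernel K M N)"

definition tensor ::
  "('k, 'r) ring_scheme \<Rightarrow> ('k, 'm, 'x) module_scheme \<Rightarrow> ('k, 'n, 'y) module_scheme
    \<Rightarrow> 'm \<Rightarrow> 'n \<Rightarrow> ('m \<times> 'n \<Rightarrow> 'k) set" where
  "tensor K M N m n =
    tensor_kernel K M N +>\<^bsub>free_module K (carrier M \<times> carrier N)\<^esub> free_gen K (m, n)"

abbreviation tensor_square_elem ::
  "'v \<Rightarrow> ('k, 'r) ring_scheme \<Rightarrow> ('k, 'v, 'x) module_scheme \<Rightarrow> 'v \<Rightarrow> ('v \<times> 'v \<Rightarrow> 'k) set"
  (\<open>(_ \<boxtimes>\<^bsub>_,_\<^esub> _)\<close> [76, 0, 0, 76] 75) where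
  "a \<boxtimes>\<^bsub>K,V\<^esub> b \<equiv> tensor K V V a b"

text \<open>
  The linear map from the tensor product of \<open>M\<close> and \<open>N\<close> to \<open>P\<close> induced by a bilinear
  map \<open>f\<close>. Elements of the tensor product are cosets of formal linear combinations of pairs;
  for bilinear \<open>f\<close> the value does not depend on the representative chosen by \<open>SOME\<close>.
\<close>

definition tensor_lift ::
  "('k, 'r) ring_scheme \<Rightarrow> ('k, 'm, 'x) module_scheme \<Rightarrow> ('k, 'n, 'y) module_scheme
    \<Rightarrow> ('k, 'p, 'z) module_scheme \<Rightarrow> ('m \<Rightarrow> 'n \<Rightarrow> 'p) \<Rightarrow> ('m \<times> 'n \<Rightarrow> 'k) set \<Rightarrow> 'p" where
  "tensor_lift K M N P f C =
    (let x = (SOME x. x \<in> C)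
     in \<Oplus>\<^bsub>P\<^esub>s\<in>{s. x s \<noteq> \<zero>\<^bsub>K\<^esub>}. x s \<odot>\<^bsub>P\<^esub> f (fst s) (snd s))"

definition tensor_map ::
  "('k, 'r) ring_scheme \<Rightarrow> ('k, 'm, 'x) module_scheme \<Rightarrow> ('k, 'n, 'y) module_scheme
    \<Rightarrow> ('k, 'm2, 'x2) module_scheme \<Rightarrow> ('k, 'n2, 'y2) module_scheme
    \<Rightarrow> ('m \<Rightarrow> 'm2) \<Rightarrow> ('n \<Rightarrow> 'n2) \<Rightarrow> ('m \<times> 'n \<Rightarrow> 'k) set \<Rightarrow> ('m2 \<times> 'n2 \<Rightarrow> 'k) set" where
  "tensor_map K M N M' N' f g =
    tensor_lift K M N (tensor_product K M' N') (\<lambda>m n. tensor K M' N' (f m) (g n))"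


section \<open>Operators on the threefold tensor power\<close>

definition tensor2 :: "('k, 'r) ring_scheme \<Rightarrow> ('k, 'v, 'x) module_scheme
    \<Rightarrow> ('k, ('v \<times> 'v \<Rightarrow> 'k) set) module" where
  "tensor2 K V = tensor_product K V V"

text \<open>The threefold tensor power is bracketed to the left.\<close>

definition tensor3 :: "('k, 'r) ring_scheme \<Rightarrow> ('k, 'v, 'x) module_scheme
    \<Rightarrow> ('k, (('v \<times> 'v \<Rightarrow> 'k) set \<times> 'v \<Rightarrow> 'k) set) module" where
  "tensor3 K V = tensor_product K (tensor2 K V) V"

definition assoc_right :: "('k, 'r) ring_scheme \<Rightarrow> ('k, 'v, 'x) module_scheme
    \<Rightarrow> (('v \<times> 'v \<Rightarrow> 'k) set \<times> 'v \<Rightarrow> 'k) set \<Rightarrow> ('v \<times> ('v \<times> 'v \<Rightarrow> 'k) set \<Rightarrow> 'k) set" where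
  "assoc_right K V =
    (let V3' = tensor_product K V (tensor2 K V) in
      tensor_lift K (tensor2 K V) V V3'
        (\<lambda>x c. tensor_lift K V V V3' (\<lambda>a b. tensor K V (tensor2 K V) a (b \<boxtimes>\<^bsub>K,V\<^esub> c)) x))"

definition assoc_left :: "('k, 'r) ring_scheme \<Rightarrow> ('k, 'v, 'x) module_scheme
    \<Rightarrow> ('v \<times> ('v \<times> 'v \<Rightarrow> 'k) set \<Rightarrow> 'k) set \<Rightarrow> (('v \<times> 'v \<Rightarrow> 'k) set \<times> 'v \<Rightarrow> 'k) set" where
  "assoc_left K V =
    tensor_lift K V (tensor2 K V) (tensor3 K V)
      (\<lambda>a y. tensor_lift K V V (tensor3 K V) (\<lambda>b c. tensor K (tensor2 K V) V (a \<boxtimes>\<^bsub>K,V\<^esub> b) c) y)"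

definition flip :: "('k, 'r) ring_scheme \<Rightarrow> ('k, 'v, 'x) module_scheme
    \<Rightarrow> ('v \<times> 'v \<Rightarrow> 'k) set \<Rightarrow> ('v \<times> 'v \<Rightarrow> 'k) set" where
  "flip K V = tensor_lift K V V (tensor2 K V) (\<lambda>a b. b \<boxtimes>\<^bsub>K,V\<^esub> a)"

definition op12 where
  "op12 K V F = tensor_map K (tensor2 K V) V (tensor2 K V) V F (\<lambda>x. x)"

definition op23 where
  "op23 K V F =
    assoc_left K V \<circ> tensor_map K V (tensor2 K V) V (tensor2 K V) (\<lambda>x. x) F \<circ> assoc_right K V"

text \<open>Swap the last two factors, act on the first two, and swap back.\<close>

definition op13 where
  "op13 K V F = op23 K V (flip K V) \<circ> op12 K V F \<circ> op23 K V (flip K V)"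


section \<open>Coloured Yang-Baxter operators\<close>

definition coloured_YB_operator ::
  "('k, 'r) ring_scheme \<Rightarrow> ('k, 'v, 'x) module_scheme \<Rightarrow> 'c set
    \<Rightarrow> ('c \<Rightarrow> 'c \<Rightarrow> ('v \<times> 'v \<Rightarrow> 'k) set \<Rightarrow> ('v \<times> 'v \<Rightarrow> 'k) set) \<Rightarrow> bool" where
  "coloured_YB_operator K V X R \<longleftrightarrow>
    vectorspace K V \<and> vectorspace.fin_dim K V \<and>
    (\<forall>u\<in>X. \<forall>v\<in>X. R u v \<in> module_hom K (tensor2 K V) (tensor2 K V)) \<and>
    (\<forall>u\<in>X. \<forall>v\<in>X. \<forall>w\<in>X. \<forall>x\<in>carrier (tensor3 K V).
      (op12 K V (R u v) \<circ> op13 K V (R u w) \<circ> op23 K V (R v w)) x =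
      (op23 K V (R v w) \<circ> op13 K V (R u w) \<circ> op12 K V (R u v)) x)"

definition inverse_operator where
  "inverse_operator K M F G \<longleftrightarrow>
    F \<in> module_hom K M M \<and> G \<in> module_hom K M M \<and>
    (\<forall>x\<in>carrier M. G (F x) = x \<and> F (G x) = x)"

definition algebra_R ::
  "('k, 'r) ring_scheme \<Rightarrow> ('k, 'a, 'x) module_scheme \<Rightarrow> 'k \<Rightarrow> 'k \<Rightarrow> 'k \<Rightarrow> 'k
    \<Rightarrow> ('a \<times> 'a \<Rightarrow> 'k) set \<Rightarrow> ('a \<times> 'a \<Rightarrow> 'k) set" where
  "algebra_R K A p q u v =
    (let T = tensor2 K A in
      tensor_lift K A A T (\<lambda>a b.
        (p \<otimes>\<^bsub>K\<^esub> (u \<ominus>\<^bsub>K\<^esub> v)) \<odot>\<^bsub>T\<^esub> (\<one>\<^bsub>A\<^esub> \<boxtimes>\<^bsub>K,A\<^esub> (a \<otimes>\<^bsub>A\<^esub> b))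
        \<oplus>\<^bsub>T\<^esub> (q \<otimes>\<^bsub>K\<^esub> (u \<ominus>\<^bsub>K\<^esub> v)) \<odot>\<^bsub>T\<^esub> ((a \<otimes>\<^bsub>A\<^esub> b) \<boxtimes>\<^bsub>K,A\<^esub> \<one>\<^bsub>A\<^esub>)
        \<ominus>\<^bsub>T\<^esub> (p \<otimes>\<^bsub>K\<^esub> u \<ominus>\<^bsub>K\<^esub> q \<otimes>\<^bsub>K\<^esub> v) \<odot>\<^bsub>T\<^esub> (b \<boxtimes>\<^bsub>K,A\<^esub> a)))"

end

theory Submission
  imports Defs "HOL-Decision_Procs.Commutative_Ring"
begin

text \<open>
  Both sides of the Yang-Baxter equation are linear, so by the universal property of the tensor product
  they need only be compared on a pure tensor \<open>a \<otimes> b \<otimes> c\<close>. There every operator merely distributes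
  products of \<open>a\<close>, \<open>b\<close>, \<open>c\<close> over the three factors, and both sides become linear combinations of the same
  ten pure tensors, such as \<open>1 \<otimes> abc \<otimes> 1\<close> or \<open>c \<otimes> b \<otimes> a\<close>, whose coefficients agree as polynomials in
  the parameters. The inverse is verified in the same way, on three pure tensors; there the
  coefficients agree because \<open>p(u - v) + q(u - v) = (pu - qv) + (qu - pv)\<close>.
\<close>

section \<open>Free modules\<close>

text \<open>The tensor product consists of cosets of finitely supported functions, and
  \<open>tensor_lift\<close> evaluates at a representative picked by \<open>SOME\<close>. No
  operator can be computed before lifts of bilinear maps are known to be independent of that
  representative. The reassociation maps are lifts of lifts and also need the inner lift to be
  linear in its parameter.

  The calculation itself separates two multiplications. Products in the algebra do not commute, but
  only products of the three letters occur, so tensors are labelled by lists of numerals: in effect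
  the identity is proved in the free algebra on three letters and then evaluated at a, b, c. What
  remains concerns commuting scalars and is settled by normalising polynomials. Comparing
  coefficients suffices whatever linear relations the algebra imposes on the ten tensors.\<close>

lemma free_module_carrier:
  "f \<in> carrier (free_module K S) \<longleftrightarrow>
    (\<forall>s. f s \<in> carrier K) \<and> finite {s. f s \<noteq> \<zero>\<^bsub>K\<^esub>} \<and> {s. f s \<noteq> \<zero>\<^bsub>K\<^esub>} \<subseteq> S"
  by (simp add: free_module_def)

lemma free_module_simps [simp]:
  "\<zero>\<^bsub>free_module K S\<^esub> = (\<lambda>_. \<zero>\<^bsub>K\<^esub>)"
  "f \<oplus>\<^bsub>free_module K S\<^esub> g = (\<lambda>s. f s \<oplus>\<^bsub>K\<^esub> g s)"
  "c \<odot>\<^bsub>free_module K S\<^esub> f = (\<lambda>s. c \<otimes>\<^bsub>K\<^esub> f s)"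
  by (simp_all add: free_module_def)

context cring
begin

lemma free_module_value_closed: "f \<in> carrier (free_module R S) \<Longrightarrow> f s \<in> carrier R"
  by (simp add: free_module_carrier)

lemma free_module_add_closed:
  assumes "f \<in> carrier (free_module R S)" "g \<in> carrier (free_module R S)"
  shows "(\<lambda>s. f s \<oplus> g s) \<in> carrier (free_module R S)"
proof -
  have "{s. f s \<oplus> g s \<noteq> \<zero>} \<subseteq> {s. f s \<noteq> \<zero>} \<union> {s. g s \<noteq> \<zero>}"
    by auto
  then show ?thesis
    using assms unfolding free_module_carrier
    by (metis (no_types, lifting) add.m_closed finite_Un finite_subset order_trans sup.bounded_iff)
qed

lemma free_module_smult_closed:
  assumes "c \<in> carrier R" "f \<in> carrier (free_module R S)"
  shows "(\<lambda>s. c \<otimes> f s) \<in> carrier (free_module R S)"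
proof -
  have "{s. c \<otimes> f s \<noteq> \<zero>} \<subseteq> {s. f s \<noteq> \<zero>}"
    using assms by auto
  then show ?thesis
    using assms unfolding free_module_carrier by (auto intro: finite_subset)
qed

lemma free_module_is_module: "module R (free_module R S)"
proof (rule module_criteria; (intro allI ballI impI; (elim conjE)?)?)
  {
    fix v assume v: "v \<in> carrier (free_module R S)"
    then have vc: "v s \<in> carrier R" for s
      by (simp add: free_module_carrier)
    \<comment> \<open>The additive inverse is taken as minus one times \<open>v\<close>, so that its
      finite support comes from closure under scalars.\<close>
    have "(\<lambda>s. \<ominus> \<one> \<otimes> v s) \<in> carrier (free_module R S)"
      using v by (intro free_module_smult_closed) auto
    moreover have "v s \<oplus> \<ominus> \<one> \<otimes> v s = \<zero>" for s
      using vc[of s] by (simp add: l_minus r_neg)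
    ultimately show "\<exists>n\<in>carrier (free_module R S).
      v \<oplus>\<^bsub>free_module R S\<^esub> n = \<zero>\<^bsub>free_module R S\<^esub>"
      by (intro bexI[of _ "\<lambda>s. \<ominus> \<one> \<otimes> v s"]) simp_all
  }

  show "\<zero>\<^bsub>free_module R S\<^esub> \<in> carrier (free_module R S)"
    by (simp add: free_module_carrier)
qed (simp_all add: fun_eq_iff free_module_add_closed free_module_smult_closed is_cring a_ac m_assoc
  l_distr r_distr free_module_value_closed)

lemma free_gen_closed: "s \<in> S \<Longrightarrow> free_gen R s \<in> carrier (free_module R S)"
  using finite_subset[of "{t. free_gen R s t \<noteq> \<zero>}" "{s}"]
  by (auto simp: free_module_carrier free_gen_def split: if_splits)

text \<open>Induction on the size of the support: one support point is split off and the function is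
  erased there.\<close>

lemma free_module_induct [consumes 1, case_names zero add]:
  assumes "f \<in> carrier (free_module R S)"
    and zero: "P (\<lambda>_. \<zero>)"
    and add: "\<And>c s g. \<lbrakk>c \<in> carrier R; s \<in> S; g \<in> carrier (free_module R S); P g\<rbrakk>
      \<Longrightarrow> P (\<lambda>t. c \<otimes> free_gen R s t \<oplus> g t)"
  shows "P f"
  using assms(1)
proof (induction "card {s. f s \<noteq> \<zero>}" arbitrary: f)
  case 0
  then have "f = (\<lambda>_. \<zero>)"
    by (auto simp: free_module_carrier)
  then show ?case
    using zero by simp
next
  case (Suc n)
  then obtain s where s: "f s \<noteq> \<zero>"
    by (metis (mono_tags, lifting) Collect_empty_eq card.empty nat.distinct(1))
  have fc: "f t \<in> carrier R" for t
    using Suc.prems by (simp add: free_module_carrier)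
  define g where "g = f(s := \<zero>)"
  have supp: "{t. g t \<noteq> \<zero>} = {t. f t \<noteq> \<zero>} - {s}"
    by (auto simp: g_def)
  have g: "g \<in> carrier (free_module R S)"
    using Suc.prems unfolding free_module_carrier supp by (auto simp: g_def)
  have "P g"
    using Suc.hyps(2) s g Suc.prems by (intro Suc.hyps(1)) (simp_all add: supp free_module_carrier)
  then have "P (\<lambda>t. f s \<otimes> free_gen R s t \<oplus> g t)"
    using s Suc.prems g by (intro add) (auto simp: free_module_carrier)
  also have "(\<lambda>t. f s \<otimes> free_gen R s t \<oplus> g t) = f"
    using fc by (auto simp: free_gen_def g_def)
  finally show ?case .
qed

end

section \<open>Universal property of the free module\<close>

context module
begin

text \<open>The sum has the shape of the one in \<open>tensor_lift\<close>, which is therefore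
  \<open>free_lift\<close> at a chosen representative.\<close>

definition free_lift :: "('s \<Rightarrow> 'c) \<Rightarrow> ('s \<Rightarrow> 'a) \<Rightarrow> 'c" where
  "free_lift f x = (\<Oplus>\<^bsub>M\<^esub>s\<in>{s. x s \<noteq> \<zero>}. x s \<odot>\<^bsub>M\<^esub> f s)"

context
  fixes S :: "'s set" and f :: "'s \<Rightarrow> 'c"
  assumes f: "f \<in> S \<rightarrow> carrier M"
begin

text \<open>Supports of different functions differ, and cancellation can shrink the support of a
  sum. Summing over any larger finite set makes such sums comparable.\<close>

lemma free_lift_superset:
  assumes x: "x \<in> carrier (free_module R S)" and U: "{s. x s \<noteq> \<zero>} \<subseteq> U" "finite U" "U \<subseteq> S"
  shows "free_lift f x = (\<Oplus>\<^bsub>M\<^esub>s\<in>U. x s \<odot>\<^bsub>M\<^esub> f s)"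
  unfolding free_lift_def
proof (rule M.add.finprod_mono_neutral_cong_left)
  show "finite U" "{s. x s \<noteq> \<zero>} \<subseteq> U"
    using U by auto
  show "(\<lambda>s. x s \<odot>\<^bsub>M\<^esub> f s) \<in> U \<rightarrow> carrier M"
    using x U f by (auto simp: free_module_carrier Pi_def subset_eq)
  show "x s \<odot>\<^bsub>M\<^esub> f s = \<zero>\<^bsub>M\<^esub>" if "s \<in> U - {s. x s \<noteq> \<zero>}" for s
    using that U f by (auto simp: Pi_def subset_eq)
qed simp

lemma free_lift_hom: "free_lift f \<in> module_hom R (free_module R S) M"
  unfolding module_hom_def
proof (intro CollectI conjI allI impI; (elim conjE)?)
  have fS: "f s \<in> carrier M" if "s \<in> S" for s
    using f that by auto
  show "free_lift f \<in> carrier (free_module R S) \<rightarrow> carrier M"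
    unfolding free_lift_def using fS
    by (auto simp: free_module_carrier subset_eq intro!: M.finsum_closed)
  fix x assume x: "x \<in> carrier (free_module R S)"
  let ?X = "{s. x s \<noteq> \<zero>}"
  have X: "finite ?X" "?X \<subseteq> S" "\<And>s. x s \<in> carrier R"
    using x by (auto simp: free_module_carrier)
  {
    fix y assume y: "y \<in> carrier (free_module R S)"
    let ?Y = "{s. y s \<noteq> \<zero>}"
    have Y: "finite ?Y" "?Y \<subseteq> S" "\<And>s. y s \<in> carrier R"
      using y by (auto simp: free_module_carrier)
    \<comment> \<open>A common index set for \<open>x\<close>, \<open>y\<close> and their
      sum.\<close>
    let ?U = "?X \<union> ?Y"
    have U: "finite ?U" "?U \<subseteq> S"
      using X Y by auto
    have "free_lift f (x \<oplus>\<^bsub>free_module R S\<^esub> y) = (\<Oplus>\<^bsub>M\<^esub>s\<in>?U. (x s \<oplus> y s) \<odot>\<^bsub>M\<^esub> f s)"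
      using free_module_add_closed[OF x y] U by (subst free_lift_superset[where U = ?U]) auto
    also have "\<dots> = (\<Oplus>\<^bsub>M\<^esub>s\<in>?U. x s \<odot>\<^bsub>M\<^esub> f s \<oplus>\<^bsub>M\<^esub> y s \<odot>\<^bsub>M\<^esub> f s)"
      using X Y fS U by (intro M.finsum_cong') (auto simp: smult_l_distr Pi_def subset_eq)
    also have "\<dots> = (\<Oplus>\<^bsub>M\<^esub>s\<in>?U. x s \<odot>\<^bsub>M\<^esub> f s) \<oplus>\<^bsub>M\<^esub> (\<Oplus>\<^bsub>M\<^esub>s\<in>?U. y s \<odot>\<^bsub>M\<^esub> f s)"
      using X(3) Y(3) fS U(2) by (intro M.finsum_addf) blast+
    also have "\<dots> = free_lift f x \<oplus>\<^bsub>M\<^esub> free_lift f y"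
      using x y U by (simp add: free_lift_superset[where U = ?U])
    finally show "free_lift f (x \<oplus>\<^bsub>free_module R S\<^esub> y) = free_lift f x \<oplus>\<^bsub>M\<^esub> free_lift f y" .
  }
  fix c assume c: "c \<in> carrier R"
  have "free_lift f (c \<odot>\<^bsub>free_module R S\<^esub> x) = (\<Oplus>\<^bsub>M\<^esub>s\<in>?X. (c \<otimes> x s) \<odot>\<^bsub>M\<^esub> f s)"
    using free_module_smult_closed[OF c x] X c by (subst free_lift_superset[where U = ?X]) auto
  also have "\<dots> = (\<Oplus>\<^bsub>M\<^esub>s\<in>?X. c \<odot>\<^bsub>M\<^esub> (x s \<odot>\<^bsub>M\<^esub> f s))"
    using X c fS by (intro M.finsum_cong') (auto simp: smult_assoc1 Pi_def subset_eq)
  also have "\<dots> = c \<odot>\<^bsub>M\<^esub> free_lift f x"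
    unfolding free_lift_def using X c fS by (intro finsum_smult_ldistr[symmetric]) auto
  finally show "free_lift f (c \<odot>\<^bsub>free_module R S\<^esub> x) = c \<odot>\<^bsub>M\<^esub> free_lift f x" .
qed

lemma free_lift_gen:
  assumes "s \<in> S"
  shows "free_lift f (free_gen R s) = f s"
proof -
  have s: "f s \<in> carrier M"
    using f assms by auto
  have "free_lift f (free_gen R s) = (\<Oplus>\<^bsub>M\<^esub>t\<in>{s}. free_gen R s t \<odot>\<^bsub>M\<^esub> f t)"
    using assms by (intro free_lift_superset free_gen_closed) (auto simp: free_gen_def)
  also have "\<dots> = f s"
    using s by (simp add: free_gen_def)
  finally show ?thesis .
qed

end

end


section \<open>Quotient modules\<close>

lemma quotient_module_simps [simp]:
  "carrier (quotient_module M N) = a_rcosets\<^bsub>M\<^esub> N"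
  "\<zero>\<^bsub>quotient_module M N\<^esub> = N"
  "C \<oplus>\<^bsub>quotient_module M N\<^esub> D = C <+>\<^bsub>M\<^esub> D"
  by (simp_all add: quotient_module_def)

context module
begin

context
  fixes N
  assumes N: "submodule R N M"
begin

lemma submodule_abelian_subgroup: "abelian_subgroup N M"
proof (rule abelian_subgroupI3)
  interpret N: submodule R N M by (rule N)
  have "\<ominus>\<^bsub>M\<^esub> x \<in> N" if "x \<in> N" for x
  proof -
    \<comment> \<open>Closure under negation comes from multiplying by minus one.\<close>
    have "\<ominus> \<one> \<odot>\<^bsub>M\<^esub> x \<in> N"
      using that by (intro N.smult_closed) auto
    moreover have "x \<in> carrier M"
      using that N.subset by auto
    ultimately show ?thesis
      by (simp add: smult_l_minus)
  qed
  moreover have "N \<noteq> {}"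
    using N.zero_closed by blast
  ultimately show "additive_subgroup N M"
    using N.subset by (intro additive_subgroupI M.add.subgroupI) (auto simp: a_inv_def)
qed (rule M.abelian_group_axioms)

lemma quotient_module_carrierE:
  assumes "C \<in> carrier (quotient_module M N)"
  obtains x where "x \<in> carrier M" "C = N +>\<^bsub>M\<^esub> x"
  using assms by (auto simp: A_RCOSETS_def')

text \<open>Scalar multiplication in the quotient is a union over all representatives. Since
  \<open>N\<close> is closed under scalars, every representative contributes the same coset, so the
  union is that single coset.\<close>

lemma quotient_module_coset_smult:
  assumes c: "c \<in> carrier R" and x: "x \<in> carrier M"
  shows "c \<odot>\<^bsub>quotient_module M N\<^esub> (N +>\<^bsub>M\<^esub> x) = N +>\<^bsub>M\<^esub> (c \<odot>\<^bsub>M\<^esub> x)"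
proof -
  interpret N: submodule R N M by (rule N)
  interpret A: abelian_subgroup N M by (rule submodule_abelian_subgroup)
  have "N +>\<^bsub>M\<^esub> (c \<odot>\<^bsub>M\<^esub> y) = N +>\<^bsub>M\<^esub> (c \<odot>\<^bsub>M\<^esub> x)" if y: "y \<in> N +>\<^bsub>M\<^esub> x" for y
  proof -
    from y obtain n where n: "n \<in> N" "y = n \<oplus>\<^bsub>M\<^esub> x"
      by (auto simp: a_r_coset_def')
    have "c \<odot>\<^bsub>M\<^esub> y = c \<odot>\<^bsub>M\<^esub> n \<oplus>\<^bsub>M\<^esub> c \<odot>\<^bsub>M\<^esub> x"
      using n c x N.subset by (auto simp: smult_r_distr)
    moreover have "c \<odot>\<^bsub>M\<^esub> n \<in> N"
      using n c by auto
    ultimately have "c \<odot>\<^bsub>M\<^esub> y \<in> N +>\<^bsub>M\<^esub> (c \<odot>\<^bsub>M\<^esub> x)"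
      by (auto simp: a_r_coset_def')
    then show ?thesis
      using A.a_repr_independence' c x by auto
  qed
  then have "(\<Union>y\<in>N +>\<^bsub>M\<^esub> x. N +>\<^bsub>M\<^esub> (c \<odot>\<^bsub>M\<^esub> y)) = (\<Union>y\<in>N +>\<^bsub>M\<^esub> x. N +>\<^bsub>M\<^esub> (c \<odot>\<^bsub>M\<^esub> x))"
    by (rule SUP_cong[OF refl])
  also have "\<dots> = N +>\<^bsub>M\<^esub> (c \<odot>\<^bsub>M\<^esub> x)"
    using A.a_rcos_self[OF x] by (intro SUP_eq_const) auto
  finally show ?thesis
    by (simp add: quotient_module_def)
qed

lemma quotient_module_coset_add:
  assumes "x \<in> carrier M" "y \<in> carrier M"
  shows "(N +>\<^bsub>M\<^esub> x) \<oplus>\<^bsub>quotient_module M N\<^esub> (N +>\<^bsub>M\<^esub> y) = N +>\<^bsub>M\<^esub> (x \<oplus>\<^bsub>M\<^esub> y)"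
  using assms abelian_subgroup.a_rcos_sum[OF submodule_abelian_subgroup] by simp

lemma quotient_module_coset_closed:
  "x \<in> carrier M \<Longrightarrow> N +>\<^bsub>M\<^esub> x \<in> carrier (quotient_module M N)"
  by (auto simp: A_RCOSETS_def')

lemma quotient_module_is_module: "module R (quotient_module M N)"
proof (rule moduleI)
  interpret A: abelian_subgroup N M by (rule submodule_abelian_subgroup)
  \<comment> \<open>Written as a coset, the zero falls under the same rules as all other elements,
    and the module laws are inherited from representatives.\<close>
  have zero: "\<zero>\<^bsub>quotient_module M N\<^esub> = N +>\<^bsub>M\<^esub> \<zero>\<^bsub>M\<^esub>"
    using A.a_rcos_const[OF A.zero_closed] by simp
  show "abelian_group (quotient_module M N)"
  proof (rule abelian_groupI)
    fix C assume "C \<in> carrier (quotient_module M N)"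
    then obtain x where x: "x \<in> carrier M" "C = N +>\<^bsub>M\<^esub> x"
      by (rule quotient_module_carrierE)
    then have "(N +>\<^bsub>M\<^esub> (\<ominus>\<^bsub>M\<^esub> x)) \<oplus>\<^bsub>quotient_module M N\<^esub> C = \<zero>\<^bsub>quotient_module M N\<^esub>"
      by (simp add: quotient_module_coset_add zero M.l_neg del: quotient_module_simps)
    then show "\<exists>D\<in>carrier (quotient_module M N).
        D \<oplus>\<^bsub>quotient_module M N\<^esub> C = \<zero>\<^bsub>quotient_module M N\<^esub>"
      using quotient_module_coset_closed x by blast
  qed (auto elim!: quotient_module_carrierE
    simp: quotient_module_coset_add zero M.a_ac simp del: quotient_module_simps
    intro!: quotient_module_coset_closed)
qed (auto elim!: quotient_module_carrierE
  simp: quotient_module_coset_smult quotient_module_coset_add smult_l_distr smult_r_distr smult_assoc1 R.is_cring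
  simp del: quotient_module_simps
  intro!: quotient_module_coset_closed)

lemma coset_hom: "(\<lambda>x. N +>\<^bsub>M\<^esub> x) \<in> module_hom R M (quotient_module M N)"
  unfolding module_hom_def
  using quotient_module_coset_smult quotient_module_coset_add quotient_module_coset_closed by auto

end

end


section \<open>Module homomorphisms\<close>

lemma module_homI:
  assumes "\<And>x. x \<in> carrier M \<Longrightarrow> f x \<in> carrier N"
    and "\<And>x y. \<lbrakk>x \<in> carrier M; y \<in> carrier M\<rbrakk> \<Longrightarrow> f (x \<oplus>\<^bsub>M\<^esub> y) = f x \<oplus>\<^bsub>N\<^esub> f y"
    and "\<And>c x. \<lbrakk>c \<in> carrier R; x \<in> carrier M\<rbrakk> \<Longrightarrow> f (c \<odot>\<^bsub>M\<^esub> x) = c \<odot>\<^bsub>N\<^esub> f x"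
  shows "f \<in> module_hom R M N"
  using assms by (auto simp: module_hom_def)

lemma module_hom_apply_closed: "\<lbrakk>f \<in> module_hom R M N; x \<in> carrier M\<rbrakk> \<Longrightarrow> f x \<in> carrier N"
  by (auto simp: module_hom_def)

lemma module_hom_id: "(\<lambda>x. x) \<in> module_hom R M M"
  by (auto simp: module_hom_def)

lemma module_hom_comp:
  assumes "f \<in> module_hom R M N" "g \<in> module_hom R N P"
  shows "(\<lambda>x. g (f x)) \<in> module_hom R M P"
  using assms by (auto simp: module_hom_def Pi_def)

lemma module_hom_zero:
  assumes "module R M" "module R N" "f \<in> module_hom R M N"
  shows "f \<zero>\<^bsub>M\<^esub> = \<zero>\<^bsub>N\<^esub>"
  by (rule mod_hom.f0_is_0[of R]) (simp add: assms mod_hom_def mod_hom_axioms_def)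

definition bilinear ::
  "('k, 'r) ring_scheme \<Rightarrow> ('k, 'm, 'x) module_scheme \<Rightarrow> ('k, 'n, 'y) module_scheme
    \<Rightarrow> ('k, 'p, 'z) module_scheme \<Rightarrow> ('m \<Rightarrow> 'n \<Rightarrow> 'p) \<Rightarrow> bool" where
  "bilinear R M N P f \<longleftrightarrow>
    (\<forall>n\<in>carrier N. (\<lambda>m. f m n) \<in> module_hom R M P) \<and>
    (\<forall>m\<in>carrier M. f m \<in> module_hom R N P)"

lemma bilinearI:
  assumes "\<And>n. n \<in> carrier N \<Longrightarrow> (\<lambda>m. f m n) \<in> module_hom R M P"
    and "\<And>m. m \<in> carrier M \<Longrightarrow> f m \<in> module_hom R N P"
  shows "bilinear R M N P f"
  using assms by (simp add: bilinear_def)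

lemma bilinear_left: "\<lbrakk>bilinear R M N P f; n \<in> carrier N\<rbrakk> \<Longrightarrow> (\<lambda>m. f m n) \<in> module_hom R M P"
  by (simp add: bilinear_def)

lemma bilinear_right: "\<lbrakk>bilinear R M N P f; m \<in> carrier M\<rbrakk> \<Longrightarrow> f m \<in> module_hom R N P"
  by (simp add: bilinear_def)

lemma bilinear_closed:
  "\<lbrakk>bilinear R M N P f; m \<in> carrier M; n \<in> carrier N\<rbrakk> \<Longrightarrow> f m n \<in> carrier P"
  by (rule module_hom_apply_closed[OF bilinear_right])

lemma bilinear_comp:
  assumes "bilinear R M' N' P h" "f \<in> module_hom R M M'" "g \<in> module_hom R N N'"
  shows "bilinear R M N P (\<lambda>m n. h (f m) (g n))"
  using assms
  by (intro bilinearI)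
    (auto intro: module_hom_comp[OF _ bilinear_left] module_hom_comp[OF _ bilinear_right]
      module_hom_apply_closed)

lemma bilinear_flip: "bilinear R M N P f \<Longrightarrow> bilinear R N M P (\<lambda>n m. f m n)"
  by (simp add: bilinear_def)

lemma bilinear_compose_hom:
  "\<lbrakk>bilinear R M N P f; g \<in> module_hom R P Q\<rbrakk> \<Longrightarrow> bilinear R M N Q (\<lambda>m n. g (f m n))"
  by (auto simp: bilinear_def intro: module_hom_comp)


section \<open>The universal property of the tensor product\<close>

locale module_pair = M: module R M + N: module R N
  for R :: "('k, 'r) ring_scheme" (structure)
    and M :: "('k, 'm, 'x) module_scheme" and N :: "('k, 'n, 'y) module_scheme"
begin

abbreviation F where "F \<equiv> free_module R (carrier M \<times> carrier N)"
abbreviation T where "T \<equiv> tensor_product R M N"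
abbreviation gen where "gen m n \<equiv> free_gen R (m, n)"

lemma free_module: "module R F"
  by (rule M.R.free_module_is_module)

sublocale F: module R F
  by (rule free_module)

lemma gen_closed: "\<lbrakk>m \<in> carrier M; n \<in> carrier N\<rbrakk> \<Longrightarrow> gen m n \<in> carrier F"
  by (intro M.R.free_gen_closed) simp

lemma bilinear_relations_subset: "bilinear_relations R M N \<subseteq> carrier F"
  unfolding bilinear_relations_def Let_def
  by (auto intro!: F.minus_closed F.a_closed F.smult_closed gen_closed simp del: free_module_simps)

lemma tensor_kernel_submodule: "submodule R (tensor_kernel R M N) F"
  unfolding tensor_kernel_def by (rule F.span_is_submodule[OF bilinear_relations_subset])

lemma bilinear_relations_kernel: "bilinear_relations R M N \<subseteq> tensor_kernel R M N"
  unfolding tensor_kernel_def by (rule F.in_own_span[OF bilinear_relations_subset])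

lemma tensor_product_is_module: "module R T"
  unfolding tensor_product_def by (rule F.quotient_module_is_module[OF tensor_kernel_submodule])

sublocale T: module R T
  by (rule tensor_product_is_module)

definition proj where "proj x = tensor_kernel R M N +>\<^bsub>F\<^esub> x"

lemma proj_hom: "proj \<in> module_hom R F T"
  unfolding proj_def[abs_def] tensor_product_def
  by (rule F.coset_hom[OF tensor_kernel_submodule])

lemma tensor_proj: "tensor R M N m n = proj (gen m n)"
  by (simp add: tensor_def proj_def)

lemma tensor_closed: "\<lbrakk>m \<in> carrier M; n \<in> carrier N\<rbrakk> \<Longrightarrow> tensor R M N m n \<in> carrier T"
  unfolding tensor_proj by (rule module_hom_apply_closed[OF proj_hom gen_closed])

text \<open>The kernel is the span of the relations, so it contains each of them, and elements that
  differ by a kernel element have the same coset.\<close>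

lemma proj_eqI:
  assumes "x \<in> carrier F" "y \<in> carrier F" "x \<ominus>\<^bsub>F\<^esub> y \<in> bilinear_relations R M N"
  shows "proj x = proj y"
proof -
  interpret A: abelian_subgroup "tensor_kernel R M N" F
    by (rule F.submodule_abelian_subgroup[OF tensor_kernel_submodule])
  have "x \<in> tensor_kernel R M N +>\<^bsub>F\<^esub> y"
    using assms bilinear_relations_kernel by (intro A.a_rcos_module_rev) (auto simp: a_minus_def)
  then show ?thesis
    unfolding proj_def using A.a_repr_independence' assms(2) by metis
qed

text \<open>Each of the four families of relations yields one law: additivity or homogeneity, in one
  of the two arguments.\<close>

lemma tensor_bilinear: "bilinear R M N T (tensor R M N)"
proof (intro bilinearI module_homI)
  note rels = bilinear_relations_def Let_def
  note hom = module_hom_add[OF proj_hom, symmetric] module_hom_smult[OF proj_hom, symmetric]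
  fix m n m' n' c
  assume m: "m \<in> carrier M" and n: "n \<in> carrier N"
  show "tensor R M N m n \<in> carrier T"
    using m n by (rule tensor_closed)
  then show "tensor R M N m n \<in> carrier T" .
  {
    assume m': "m' \<in> carrier M"
    have "proj (gen (m \<oplus>\<^bsub>M\<^esub> m') n) = proj (gen m n \<oplus>\<^bsub>F\<^esub> gen m' n)"
    proof (rule proj_eqI)
      show "gen (m \<oplus>\<^bsub>M\<^esub> m') n \<ominus>\<^bsub>F\<^esub> (gen m n \<oplus>\<^bsub>F\<^esub> gen m' n) \<in> bilinear_relations R M N"
        unfolding rels using m m' n by blast
    qed (use m m' n in \<open>auto intro!: gen_closed F.a_closed simp del: free_module_simps\<close>)
    then show "tensor R M N (m \<oplus>\<^bsub>M\<^esub> m') n = tensor R M N m n \<oplus>\<^bsub>T\<^esub> tensor R M N m' n"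
      using m m' n by (simp add: tensor_proj hom gen_closed del: free_module_simps)
  }
  {
    assume n': "n' \<in> carrier N"
    have "proj (gen m (n \<oplus>\<^bsub>N\<^esub> n')) = proj (gen m n \<oplus>\<^bsub>F\<^esub> gen m n')"
    proof (rule proj_eqI)
      show "gen m (n \<oplus>\<^bsub>N\<^esub> n') \<ominus>\<^bsub>F\<^esub> (gen m n \<oplus>\<^bsub>F\<^esub> gen m n') \<in> bilinear_relations R M N"
        unfolding rels using m n n' by blast
    qed (use m n n' in \<open>auto intro!: gen_closed F.a_closed simp del: free_module_simps\<close>)
    then show "tensor R M N m (n \<oplus>\<^bsub>N\<^esub> n') = tensor R M N m n \<oplus>\<^bsub>T\<^esub> tensor R M N m n'"
      using m n n' by (simp add: tensor_proj hom gen_closed del: free_module_simps)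
  }
  assume c: "c \<in> carrier R"
  have "proj (gen (c \<odot>\<^bsub>M\<^esub> m) n) = proj (c \<odot>\<^bsub>F\<^esub> gen m n)"
  proof (rule proj_eqI)
    show "gen (c \<odot>\<^bsub>M\<^esub> m) n \<ominus>\<^bsub>F\<^esub> c \<odot>\<^bsub>F\<^esub> gen m n \<in> bilinear_relations R M N"
      unfolding rels using m n c by blast
  qed (use m n c in \<open>auto intro!: gen_closed F.smult_closed simp del: free_module_simps\<close>)
  then show "tensor R M N (c \<odot>\<^bsub>M\<^esub> m) n = c \<odot>\<^bsub>T\<^esub> tensor R M N m n"
    using m n c by (simp add: tensor_proj hom gen_closed del: free_module_simps)
  have "proj (gen m (c \<odot>\<^bsub>N\<^esub> n)) = proj (c \<odot>\<^bsub>F\<^esub> gen m n)"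
  proof (rule proj_eqI)
    show "gen m (c \<odot>\<^bsub>N\<^esub> n) \<ominus>\<^bsub>F\<^esub> c \<odot>\<^bsub>F\<^esub> gen m n \<in> bilinear_relations R M N"
      unfolding rels using m n c by blast
  qed (use m n c in \<open>auto intro!: gen_closed F.smult_closed simp del: free_module_simps\<close>)
  then show "tensor R M N m (c \<odot>\<^bsub>N\<^esub> n) = c \<odot>\<^bsub>T\<^esub> tensor R M N m n"
    using m n c by (simp add: tensor_proj hom gen_closed del: free_module_simps)
qed

lemmas tensor_hom_left = bilinear_left[OF tensor_bilinear]

lemma tensor_product_carrierE:
  assumes "x \<in> carrier T"
  obtains f where "f \<in> carrier F" "x = proj f"
  using assms F.quotient_module_carrierE[OF tensor_kernel_submodule]
  by (auto simp: tensor_product_def proj_def simp del: quotient_module_simps)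

text \<open>There is no case for scalars because a multiple of a pure tensor is again pure: the
  scalar moves into the left factor.\<close>

lemma tensor_product_induct [consumes 1, case_names zero tensor add]:
  assumes "x \<in> carrier T"
    and zero: "P \<zero>\<^bsub>T\<^esub>"
    and tensor: "\<And>m n. \<lbrakk>m \<in> carrier M; n \<in> carrier N\<rbrakk> \<Longrightarrow> P (tensor R M N m n)"
    and add: "\<And>x y. \<lbrakk>x \<in> carrier T; y \<in> carrier T; P x; P y\<rbrakk> \<Longrightarrow> P (x \<oplus>\<^bsub>T\<^esub> y)"
  shows "P x"
proof -
  obtain f where f: "f \<in> carrier F" "x = proj f"
    using assms(1) by (rule tensor_product_carrierE)
  from f(1) have "P (proj f)"
  proof (induction f rule: M.R.free_module_induct)
    case zero
    show ?case
      using module_hom_zero[OF free_module tensor_product_is_module proj_hom] assms(2) by simp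
  next
    case (add c s g)
    obtain m n where s: "s = (m, n)" "m \<in> carrier M" "n \<in> carrier N"
      using add.hyps by auto
    have "proj (c \<odot>\<^bsub>F\<^esub> gen m n \<oplus>\<^bsub>F\<^esub> g) = tensor R M N (c \<odot>\<^bsub>M\<^esub> m) n \<oplus>\<^bsub>T\<^esub> proj g"
      using add.hyps s
      by (simp add: module_hom_add[OF proj_hom] module_hom_smult[OF proj_hom] gen_closed
          module_hom_smult[OF tensor_hom_left] tensor_proj[symmetric] F.smult_closed
          del: free_module_simps)
    moreover have "P (tensor R M N (c \<odot>\<^bsub>M\<^esub> m) n \<oplus>\<^bsub>T\<^esub> proj g)"
      using add s by (intro assms(4) tensor tensor_closed M.smult_closed
          module_hom_apply_closed[OF proj_hom])
    ultimately show ?case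
      by (simp add: s)
  qed
  then show ?thesis
    using f by simp
qed

lemma hom_eqI:
  assumes P: "module R P" and f: "f \<in> module_hom R T P" and g: "g \<in> module_hom R T P"
    and eq: "\<And>m n. \<lbrakk>m \<in> carrier M; n \<in> carrier N\<rbrakk> \<Longrightarrow> f (tensor R M N m n) = g (tensor R M N m n)"
    and x: "x \<in> carrier T"
  shows "f x = g x"
  using x
proof (induction x rule: tensor_product_induct)
  case zero
  show ?case
    by (simp only: module_hom_zero[OF tensor_product_is_module P f] module_hom_zero[OF tensor_product_is_module P g])
next
  case (add x y)
  then show ?case
    by (simp only: module_hom_add[OF f] module_hom_add[OF g])
qed (rule eq)

context
  fixes P :: "('k, 'p, 'z) module_scheme" and f :: "'m \<Rightarrow> 'n \<Rightarrow> 'p"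
  assumes P: "module R P" and f: "bilinear R M N P f"
begin

interpretation P: module R P
  by (rule P)

lemma uncurry_closed: "(\<lambda>s. f (fst s) (snd s)) \<in> carrier M \<times> carrier N \<rightarrow> carrier P"
  using bilinear_closed[OF f] by auto

text \<open>This is well-definedness. The lift to the free module vanishes on the relations, hence
  on their span, so it takes the same value at all representatives of a coset.\<close>

lemma tensor_lift_proj:
  assumes x: "x \<in> carrier F"
  shows "tensor_lift R M N P f (proj x) = P.free_lift (\<lambda>s. f (fst s) (snd s)) x"
proof -
  let ?L = "P.free_lift (\<lambda>s. f (fst s) (snd s))"
  have L: "?L \<in> module_hom R F P"
    by (rule P.free_lift_hom[OF uncurry_closed])
  interpret L: mod_hom R F P ?L
    by unfold_locales (rule L)
  have gen: "?L (gen m n) = f m n" if "m \<in> carrier M" "n \<in> carrier N" for m n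
    using that by (subst P.free_lift_gen[OF uncurry_closed]) auto
  note [simp] = gen gen_closed bilinear_closed[OF f] module_hom_add[OF bilinear_left[OF f]]
    module_hom_add[OF bilinear_right[OF f]] module_hom_smult[OF bilinear_left[OF f]]
    module_hom_smult[OF bilinear_right[OF f]] P.r_neg
  \<comment> \<open>Each relation is a difference whose two parts have the same image by bilinearity
    of \<open>f\<close>.\<close>
  have "bilinear_relations R M N \<subseteq> L.ker"
    using bilinear_relations_subset unfolding L.ker_def bilinear_relations_def Let_def
    by (auto simp: L.f_minus F.smult_closed F.a_closed a_minus_def[of P] simp del: free_module_simps)
  then have ker: "tensor_kernel R M N \<subseteq> L.ker"
    unfolding tensor_kernel_def by (intro F.span_is_subset L.ker_is_submodule)
  interpret A: abelian_subgroup "tensor_kernel R M N" F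
    by (rule F.submodule_abelian_subgroup[OF tensor_kernel_submodule])
  \<comment> \<open>The representative that \<open>tensor_lift\<close> picks. It differs from
    \<open>x\<close> by an element \<open>k\<close> of the kernel.\<close>
  define y where "y = (SOME y. y \<in> proj x)"
  have "x \<in> proj x"
    unfolding proj_def by (rule A.a_rcos_self[OF x])
  then have "y \<in> proj x"
    unfolding y_def by (rule someI[of "\<lambda>y. y \<in> proj x"])
  then obtain k where k: "k \<in> tensor_kernel R M N" "y = k \<oplus>\<^bsub>F\<^esub> x"
    by (auto simp: proj_def a_r_coset_def' simp del: free_module_simps)
  have "k \<in> carrier F" "?L k = \<zero>\<^bsub>P\<^esub>"
    using k ker by (auto simp: L.ker_def)
  then have "?L y = ?L x"
    using x k(2) by (simp add: L.f_im del: free_module_simps)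
  then show ?thesis
    by (simp add: tensor_lift_def P.free_lift_def y_def)
qed

lemma tensor_lift_hom: "tensor_lift R M N P f \<in> module_hom R T P"
proof (rule module_homI)
  let ?L = "P.free_lift (\<lambda>s. f (fst s) (snd s))"
  have L: "?L \<in> module_hom R F P"
    by (rule P.free_lift_hom[OF uncurry_closed])
  note hom = module_hom_add[OF proj_hom, symmetric] module_hom_smult[OF proj_hom, symmetric]
  fix x assume "x \<in> carrier T"
  then obtain x' where x: "x' \<in> carrier F" "x = proj x'"
    by (rule tensor_product_carrierE)
  then show "tensor_lift R M N P f x \<in> carrier P"
    by (simp add: tensor_lift_proj module_hom_apply_closed[OF L])
  show "tensor_lift R M N P f (c \<odot>\<^bsub>T\<^esub> x) = c \<odot>\<^bsub>P\<^esub> tensor_lift R M N P f x" if "c \<in> carrier R" for c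
    using x that
    by (simp add: hom tensor_lift_proj module_hom_smult[OF L] F.smult_closed del: free_module_simps)
  fix y assume "y \<in> carrier T"
  then obtain y' where y: "y' \<in> carrier F" "y = proj y'"
    by (rule tensor_product_carrierE)
  show "tensor_lift R M N P f (x \<oplus>\<^bsub>T\<^esub> y) = tensor_lift R M N P f x \<oplus>\<^bsub>P\<^esub> tensor_lift R M N P f y"
    using x y
    by (simp add: hom tensor_lift_proj module_hom_add[OF L] F.a_closed del: free_module_simps)
qed

lemma tensor_lift_tensor:
  assumes "m \<in> carrier M" "n \<in> carrier N"
  shows "tensor_lift R M N P f (tensor R M N m n) = f m n"
  using assms
  by (simp add: tensor_proj tensor_lift_proj gen_closed P.free_lift_gen[OF uncurry_closed])

end

text \<open>This makes a lift of lifts possible: the outer map is bilinear only if the inner lift is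
  linear in its parameter. The assumption \<open>lin\<close> gives this on pure tensors, and
  induction on \<open>x\<close> extends it.\<close>

lemma tensor_lift_param_hom:
  assumes P: "module R P" and Q: "module R Q"
    and f: "\<And>q. q \<in> carrier Q \<Longrightarrow> bilinear R M N P (f q)"
    and lin: "\<And>m n. \<lbrakk>m \<in> carrier M; n \<in> carrier N\<rbrakk> \<Longrightarrow> (\<lambda>q. f q m n) \<in> module_hom R Q P"
    and x: "x \<in> carrier T"
  shows "(\<lambda>q. tensor_lift R M N P (f q) x) \<in> module_hom R Q P"
proof -
  interpret P: module R P by (rule P)
  interpret Q: module R Q by (rule Q)
  note L = tensor_lift_hom[OF P f]
  note closed = module_hom_apply_closed[OF L]
  show ?thesis
  proof (rule module_homI)
    fix q assume q: "q \<in> carrier Q"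
    show "tensor_lift R M N P (f q) x \<in> carrier P"
      using closed q x by simp
    show "tensor_lift R M N P (f (q \<oplus>\<^bsub>Q\<^esub> r)) x =
        tensor_lift R M N P (f q) x \<oplus>\<^bsub>P\<^esub> tensor_lift R M N P (f r) x" if r: "r \<in> carrier Q" for r
      using x
    proof (induction x rule: tensor_product_induct)
      case zero
      then show ?case
        using q r by (simp add: module_hom_zero[OF tensor_product_is_module P L])
    next
      case (tensor m n)
      then show ?case
        using q r by (simp add: tensor_lift_tensor[OF P f] module_hom_add[OF lin])
    next
      case (add x y)
      then show ?case
        using q r by (simp add: module_hom_add[OF L] closed P.a_ac)
    qed
    show "tensor_lift R M N P (f (c \<odot>\<^bsub>Q\<^esub> q)) x = c \<odot>\<^bsub>P\<^esub> tensor_lift R M N P (f q) x"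
      if c: "c \<in> carrier R" for c
      using x
    proof (induction x rule: tensor_product_induct)
      case zero
      then show ?case
        using q c by (simp add: module_hom_zero[OF tensor_product_is_module P L])
    next
      case (tensor m n)
      then show ?case
        using q c by (simp add: tensor_lift_tensor[OF P f] module_hom_smult[OF lin])
    next
      case (add x y)
      then show ?case
        using q c by (simp add: module_hom_add[OF L] closed P.smult_r_distr)
    qed
  qed
qed

end

lemma tensor_map_hom:
  assumes "module_pair R M N" "module_pair R M' N'"
    and f: "f \<in> module_hom R M M'" and g: "g \<in> module_hom R N N'"
  shows "tensor_map R M N M' N' f g \<in> module_hom R (tensor_product R M N) (tensor_product R M' N')"
    and "\<lbrakk>m \<in> carrier M; n \<in> carrier N\<rbrakk>
      \<Longrightarrow> tensor_map R M N M' N' f g (tensor R M N m n) = tensor R M' N' (f m) (g n)"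
proof -
  interpret A: module_pair R M N by fact
  interpret B: module_pair R M' N' by fact
  note bil = bilinear_comp[OF B.tensor_bilinear f g]
  show "tensor_map R M N M' N' f g \<in> module_hom R (tensor_product R M N) (tensor_product R M' N')"
    unfolding tensor_map_def by (rule A.tensor_lift_hom[OF B.tensor_product_is_module bil])
  show "tensor_map R M N M' N' f g (tensor R M N m n) = tensor R M' N' (f m) (g n)"
    if "m \<in> carrier M" "n \<in> carrier N"
    unfolding tensor_map_def
    by (rule A.tensor_lift_tensor[OF B.tensor_product_is_module bil that])
qed


section \<open>Operators on the threefold tensor power\<close>

text \<open>A list with possibly repeated indices instead of a finitely supported function: applying
  an operator then only rewrites a concrete list, and like terms are collected at the end.\<close>

definition list_comb :: "('k, 'm, 'x) module_scheme \<Rightarrow> ('i \<Rightarrow> 'm) \<Rightarrow> ('k \<times> 'i) list \<Rightarrow> 'm" where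
  "list_comb M w ts = foldr (\<lambda>(c, i) y. c \<odot>\<^bsub>M\<^esub> w i \<oplus>\<^bsub>M\<^esub> y) ts \<zero>\<^bsub>M\<^esub>"

lemma list_comb_Nil [simp]: "list_comb M w [] = \<zero>\<^bsub>M\<^esub>"
  by (simp add: list_comb_def)

lemma list_comb_Cons [simp]:
  "list_comb M w ((c, i) # ts) = c \<odot>\<^bsub>M\<^esub> w i \<oplus>\<^bsub>M\<^esub> list_comb M w ts"
  by (simp add: list_comb_def)

text \<open>\<open>act12\<close>, \<open>act13\<close> and \<open>act23\<close> relabel indices by
  inserting the untouched factor. This turns the relabelling into a change of vectors.\<close>

lemma list_comb_reindex: "list_comb M w (map (\<lambda>(c, i). (c, g i)) ts) = list_comb M (\<lambda>i. w (g i)) ts"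
  by (induction ts) auto

context module
begin

lemma list_comb_closed:
  assumes "\<And>i. w i \<in> carrier M" "fst ` set ts \<subseteq> carrier R"
  shows "list_comb M w ts \<in> carrier M"
  using assms by (induction ts) auto

lemma list_comb_append:
  assumes "\<And>i. w i \<in> carrier M" "fst ` set ts \<subseteq> carrier R" "fst ` set us \<subseteq> carrier R"
  shows "list_comb M w (ts @ us) = list_comb M w ts \<oplus>\<^bsub>M\<^esub> list_comb M w us"
  using assms by (induction ts) (auto simp: list_comb_closed M.a_assoc)

lemma list_comb_smult:
  assumes "\<And>i. w i \<in> carrier M" "fst ` set ts \<subseteq> carrier R" "c \<in> carrier R"
  shows "list_comb M w (map (\<lambda>(d, i). (c \<otimes> d, i)) ts) = c \<odot>\<^bsub>M\<^esub> list_comb M w ts"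
  using assms by (induction ts) (auto simp: list_comb_closed smult_r_distr smult_assoc1)

end

lemma module_hom_list_comb:
  assumes M: "module R M" and N: "module R N" and f: "f \<in> module_hom R M N"
    and w: "\<And>i. w i \<in> carrier M" and ts: "fst ` set ts \<subseteq> carrier R"
  shows "f (list_comb M w ts) = list_comb N (\<lambda>i. f (w i)) ts"
  using ts
proof (induction ts)
  case Nil
  show ?case
    by (simp add: module_hom_zero[OF M N f])
next
  case (Cons t ts)
  then show ?case
    by (cases t) (simp add: module_hom_add[OF f] module_hom_smult[OF f] w module.list_comb_closed[OF M]
        module.smult_closed[OF M])
qed

section \<open>Reassociation and operators on two of three factors\<close>

context module
begin

abbreviation pure2 :: "'c \<Rightarrow> 'c \<Rightarrow> ('c \<times> 'c \<Rightarrow> 'a) set" where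
  "pure2 a b \<equiv> tensor R M M a b"

abbreviation pure3 :: "'c \<Rightarrow> 'c \<Rightarrow> 'c \<Rightarrow> (('c \<times> 'c \<Rightarrow> 'a) set \<times> 'c \<Rightarrow> 'a) set" where
  "pure3 a b c \<equiv> tensor R (tensor2 R M) M (pure2 a b) c"

abbreviation pure3' :: "'c \<Rightarrow> 'c \<Rightarrow> 'c \<Rightarrow> ('c \<times> ('c \<times> 'c \<Rightarrow> 'a) set \<Rightarrow> 'a) set" where
  "pure3' a b c \<equiv> tensor R M (tensor2 R M) a (pure2 b c)"

lemma module_pair_self: "module_pair R M M"
  by (simp add: module_pair_def module_axioms)

lemma tensor2_is_module: "module R (tensor2 R M)"
  unfolding tensor2_def by (rule module_pair.tensor_product_is_module[OF module_pair_self])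

lemma module_pair_21: "module_pair R (tensor2 R M) M"
  by (simp add: module_pair_def module_axioms tensor2_is_module)

lemma module_pair_12: "module_pair R M (tensor2 R M)"
  by (simp add: module_pair_def module_axioms tensor2_is_module)

lemma tensor3_is_module: "module R (tensor3 R M)"
  unfolding tensor3_def by (rule module_pair.tensor_product_is_module[OF module_pair_21])

lemmas pure2_bilinear = module_pair.tensor_bilinear[OF module_pair_self, folded tensor2_def]
lemmas tensor21_bilinear = module_pair.tensor_bilinear[OF module_pair_21, folded tensor3_def]
lemmas tensor12_bilinear = module_pair.tensor_bilinear[OF module_pair_12]
lemmas tensor12_is_module = module_pair.tensor_product_is_module[OF module_pair_12]
lemmas pure2_closed = bilinear_closed[OF pure2_bilinear]
lemmas tensor21_closed = bilinear_closed[OF tensor21_bilinear]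
lemmas tensor2_lift_hom = module_pair.tensor_lift_hom[OF module_pair_self, folded tensor2_def]
lemmas tensor2_lift_pure = module_pair.tensor_lift_tensor[OF module_pair_self]

lemma pure3_closed:
  "\<lbrakk>a \<in> carrier M; b \<in> carrier M; c \<in> carrier M\<rbrakk> \<Longrightarrow> pure3 a b c \<in> carrier (tensor3 R M)"
  by (intro tensor21_closed pure2_closed)

text \<open>For fixed \<open>c\<close>, tensoring with \<open>c\<close> on the right is a
  homomorphism. Uniqueness is therefore applied twice, to the outer tensor product and then to the
  inner one.\<close>

lemma tensor3_hom_eqI:
  assumes P: "module R P" and f: "f \<in> module_hom R (tensor3 R M) P"
    and g: "g \<in> module_hom R (tensor3 R M) P"
    and eq: "\<And>a b c. \<lbrakk>a \<in> carrier M; b \<in> carrier M; c \<in> carrier M\<rbrakk> \<Longrightarrow> f (pure3 a b c) = g (pure3 a b c)"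
    and x: "x \<in> carrier (tensor3 R M)"
  shows "f x = g x"
proof (rule module_pair.hom_eqI[OF module_pair_21 P, folded tensor3_def, OF f g _ x])
  fix y c assume y: "y \<in> carrier (tensor2 R M)" and c: "c \<in> carrier M"
  have l: "(\<lambda>y. tensor R (tensor2 R M) M y c) \<in> module_hom R (tensor2 R M) (tensor3 R M)"
    by (rule bilinear_left[OF tensor21_bilinear c])
  show "f (tensor R (tensor2 R M) M y c) = g (tensor R (tensor2 R M) M y c)"
    by (rule module_pair.hom_eqI[OF module_pair_self P, folded tensor2_def,
          OF module_hom_comp[OF l f] module_hom_comp[OF l g] _ y])
      (use eq c in auto)
qed

lemma flip_hom: "flip R M \<in> module_hom R (tensor2 R M) (tensor2 R M)"
  and flip_pure: "\<lbrakk>a \<in> carrier M; b \<in> carrier M\<rbrakk> \<Longrightarrow> flip R M (pure2 a b) = pure2 b a"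
  unfolding flip_def
  using tensor2_lift_hom[OF tensor2_is_module bilinear_flip[OF pure2_bilinear]]
    tensor2_lift_pure[OF tensor2_is_module bilinear_flip[OF pure2_bilinear]] by auto

lemma assoc_right_hom:
    "assoc_right R M \<in> module_hom R (tensor3 R M) (tensor_product R M (tensor2 R M))" (is ?hom)
  and assoc_right_pure: "\<lbrakk>a \<in> carrier M; b \<in> carrier M; c \<in> carrier M\<rbrakk>
    \<Longrightarrow> assoc_right R M (pure3 a b c) = pure3' a b c"
proof -
  let ?V = "tensor_product R M (tensor2 R M)"
  have inner: "bilinear R M M ?V (\<lambda>a b. pure3' a b c)" if "c \<in> carrier M" for c
    by (rule bilinear_comp[OF tensor12_bilinear module_hom_id bilinear_left[OF pure2_bilinear that]])
  have param: "(\<lambda>c. pure3' a b c) \<in> module_hom R M ?V" if "a \<in> carrier M" "b \<in> carrier M" for a b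
    by (rule module_hom_comp[OF bilinear_right[OF pure2_bilinear that(2)]
          bilinear_right[OF tensor12_bilinear that(1)]])
  \<comment> \<open>Linearity in \<open>x\<close> is that of a lift. Linearity in \<open>c\<close>,
    on which the lifted map depends, is \<open>tensor_lift_param_hom\<close>.\<close>
  have outer: "bilinear R (tensor2 R M) M ?V (\<lambda>x c. tensor_lift R M M ?V (\<lambda>a b. pure3' a b c) x)"
  proof (rule bilinearI)
    show "(\<lambda>x. tensor_lift R M M ?V (\<lambda>a b. pure3' a b c) x) \<in> module_hom R (tensor2 R M) ?V"
      if "c \<in> carrier M" for c
      by (rule tensor2_lift_hom[OF tensor12_is_module inner[OF that]])
    show "(\<lambda>c. tensor_lift R M M ?V (\<lambda>a b. pure3' a b c) x) \<in> module_hom R M ?V"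
      if "x \<in> carrier (tensor2 R M)" for x
      by (rule module_pair.tensor_lift_param_hom[OF module_pair_self tensor12_is_module module_axioms
            inner param, folded tensor2_def, OF _ _ _ that])
  qed
  show ?hom
    unfolding assoc_right_def Let_def
    by (rule module_pair.tensor_lift_hom[OF module_pair_21 tensor12_is_module outer, folded tensor3_def])
  show "assoc_right R M (pure3 a b c) = pure3' a b c"
    if "a \<in> carrier M" "b \<in> carrier M" "c \<in> carrier M"
    unfolding assoc_right_def Let_def
    by (subst module_pair.tensor_lift_tensor[OF module_pair_21 tensor12_is_module outer])
      (use that in \<open>simp_all add: pure2_closed tensor2_lift_pure[OF tensor12_is_module inner]\<close>)
qed

lemma assoc_left_hom:
    "assoc_left R M \<in> module_hom R (tensor_product R M (tensor2 R M)) (tensor3 R M)" (is ?hom)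
  and assoc_left_pure: "\<lbrakk>a \<in> carrier M; b \<in> carrier M; c \<in> carrier M\<rbrakk>
    \<Longrightarrow> assoc_left R M (pure3' a b c) = pure3 a b c"
proof -
  let ?V = "tensor3 R M"
  have inner: "bilinear R M M ?V (\<lambda>b c. pure3 a b c)" if "a \<in> carrier M" for a
    by (rule bilinear_comp[OF tensor21_bilinear bilinear_right[OF pure2_bilinear that] module_hom_id])
  have param: "(\<lambda>a. pure3 a b c) \<in> module_hom R M ?V" if "b \<in> carrier M" "c \<in> carrier M" for b c
    by (rule module_hom_comp[OF bilinear_left[OF pure2_bilinear that(1)]
          bilinear_left[OF tensor21_bilinear that(2)]])
  \<comment> \<open>The mirror image: here the first factor is the parameter of the inner
    lift.\<close>
  have outer: "bilinear R M (tensor2 R M) ?V (\<lambda>a y. tensor_lift R M M ?V (\<lambda>b c. pure3 a b c) y)"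
  proof (rule bilinearI)
    show "(\<lambda>y. tensor_lift R M M ?V (\<lambda>b c. pure3 a b c) y) \<in> module_hom R (tensor2 R M) ?V"
      if "a \<in> carrier M" for a
      by (rule tensor2_lift_hom[OF tensor3_is_module inner[OF that]])
    show "(\<lambda>a. tensor_lift R M M ?V (\<lambda>b c. pure3 a b c) y) \<in> module_hom R M ?V"
      if "y \<in> carrier (tensor2 R M)" for y
      by (rule module_pair.tensor_lift_param_hom[OF module_pair_self tensor3_is_module module_axioms
            inner param, folded tensor2_def, OF _ _ _ that])
  qed
  show ?hom
    unfolding assoc_left_def
    by (rule module_pair.tensor_lift_hom[OF module_pair_12 tensor3_is_module outer])
  show "assoc_left R M (pure3' a b c) = pure3 a b c"
    if "a \<in> carrier M" "b \<in> carrier M" "c \<in> carrier M"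
    unfolding assoc_left_def
    by (subst module_pair.tensor_lift_tensor[OF module_pair_12 tensor3_is_module outer])
      (use that in \<open>simp_all add: pure2_closed tensor2_lift_pure[OF tensor3_is_module inner]\<close>)
qed

context
  fixes F
  assumes F: "F \<in> module_hom R (tensor2 R M) (tensor2 R M)"
begin

lemmas map_F_id = tensor_map_hom[OF module_pair_21 module_pair_21 F module_hom_id, folded tensor3_def]
lemmas map_id_F = tensor_map_hom[OF module_pair_12 module_pair_12 module_hom_id F]

lemma op12_hom: "op12 R M F \<in> module_hom R (tensor3 R M) (tensor3 R M)"
  unfolding op12_def by (rule map_F_id)

lemma op23_hom: "op23 R M F \<in> module_hom R (tensor3 R M) (tensor3 R M)"
  unfolding op23_def comp_def
  by (intro module_hom_comp[OF assoc_right_hom] module_hom_comp[OF map_id_F(1)] assoc_left_hom)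

context
  fixes x y :: "'i \<Rightarrow> 'c" and ts :: "('a \<times> 'i) list"
  assumes x: "\<And>i. x i \<in> carrier M" and y: "\<And>i. y i \<in> carrier M"
    and ts: "fst ` set ts \<subseteq> carrier R"
begin

text \<open>The expansion of \<open>F\<close> keeps scalars apart from vectors. Tensoring with the
  third factor changes only the vectors, and the list \<open>ts\<close> is carried over as it
  is.\<close>

lemma op12_pure:
  assumes abc: "a \<in> carrier M" "b \<in> carrier M" "c \<in> carrier M"
    and Fab: "F (pure2 a b) = list_comb (tensor2 R M) (\<lambda>i. pure2 (x i) (y i)) ts"
  shows "op12 R M F (pure3 a b c) = list_comb (tensor3 R M) (\<lambda>i. pure3 (x i) (y i) c) ts"
proof -
  have "op12 R M F (pure3 a b c) = tensor R (tensor2 R M) M (F (pure2 a b)) c"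
    unfolding op12_def using abc by (intro map_F_id(2) pure2_closed)
  also have "\<dots> = list_comb (tensor3 R M) (\<lambda>i. pure3 (x i) (y i) c) ts"
    unfolding Fab using x y
    by (intro module_hom_list_comb[OF tensor2_is_module tensor3_is_module
          bilinear_left[OF tensor21_bilinear abc(3)] _ ts] pure2_closed)
  finally show ?thesis .
qed

lemma op23_pure:
  assumes abc: "a \<in> carrier M" "b \<in> carrier M" "c \<in> carrier M"
    and Fbc: "F (pure2 b c) = list_comb (tensor2 R M) (\<lambda>i. pure2 (x i) (y i)) ts"
  shows "op23 R M F (pure3 a b c) = list_comb (tensor3 R M) (\<lambda>i. pure3 a (x i) (y i)) ts"
proof -
  have "op23 R M F (pure3 a b c) = assoc_left R M (tensor R M (tensor2 R M) a (F (pure2 b c)))"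
    unfolding op23_def comp_def using abc by (simp add: assoc_right_pure map_id_F(2) pure2_closed)
  also have "\<dots> = list_comb (tensor3 R M) (\<lambda>i. assoc_left R M (pure3' a (x i) (y i))) ts"
    unfolding Fbc using x y
    by (intro module_hom_list_comb[OF tensor2_is_module tensor3_is_module
          module_hom_comp[OF bilinear_right[OF tensor12_bilinear abc(1)] assoc_left_hom] _ ts] pure2_closed)
  also have "\<dots> = list_comb (tensor3 R M) (\<lambda>i. pure3 a (x i) (y i)) ts"
    using x y abc by (simp add: assoc_left_pure)
  finally show ?thesis .
qed

end

end

lemma op23_flip_pure:
  assumes "a \<in> carrier M" "b \<in> carrier M" "c \<in> carrier M"
  shows "op23 R M (flip R M) (pure3 a b c) = pure3 a c b"
proof -
  interpret T2: module R "tensor2 R M" by (rule tensor2_is_module)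
  interpret T3: module R "tensor3 R M" by (rule tensor3_is_module)
  \<comment> \<open>A single tensor is treated as a combination with one entry, indexed by
    \<open>unit\<close>, so that \<open>op23_pure\<close> applies.\<close>
  have "op23 R M (flip R M) (pure3 a b c) =
      list_comb (tensor3 R M) (\<lambda>_::unit. pure3 a c b) [(\<one>, ())]"
    using assms by (intro op23_pure flip_hom) (auto simp: flip_pure pure2_closed)
  then show ?thesis
    using assms by (simp add: pure3_closed)
qed

lemma op13_hom:
  assumes "F \<in> module_hom R (tensor2 R M) (tensor2 R M)"
  shows "op13 R M F \<in> module_hom R (tensor3 R M) (tensor3 R M)"
  unfolding op13_def comp_def
  by (intro module_hom_comp[OF op23_hom] module_hom_comp[OF op12_hom] op23_hom flip_hom assms)

text \<open>The first swap brings \<open>c\<close> next to \<open>a\<close>, where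
  \<open>op12\<close> can act; the second returns the untouched \<open>b\<close> to the
  middle.\<close>

lemma op13_pure:
  assumes F: "F \<in> module_hom R (tensor2 R M) (tensor2 R M)"
    and x: "\<And>i. x i \<in> carrier M" and y: "\<And>i. y i \<in> carrier M"
    and ts: "fst ` set ts \<subseteq> carrier R"
    and abc: "a \<in> carrier M" "b \<in> carrier M" "c \<in> carrier M"
    and Fac: "F (pure2 a c) = list_comb (tensor2 R M) (\<lambda>i. pure2 (x i) (y i)) ts"
  shows "op13 R M F (pure3 a b c) = list_comb (tensor3 R M) (\<lambda>i. pure3 (x i) b (y i)) ts"
proof -
  let ?S = "op23 R M (flip R M)"
  have "op13 R M F (pure3 a b c) = ?S (op12 R M F (pure3 a c b))"
    using abc by (simp add: op13_def op23_flip_pure)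
  also have "\<dots> = ?S (list_comb (tensor3 R M) (\<lambda>i. pure3 (x i) (y i) b) ts)"
    using abc by (simp add: op12_pure[OF F x y ts _ _ _ Fac])
  also have "\<dots> = list_comb (tensor3 R M) (\<lambda>i. ?S (pure3 (x i) (y i) b)) ts"
    using x y abc
    by (intro module_hom_list_comb[OF tensor3_is_module tensor3_is_module op23_hom[OF flip_hom] _ ts]
        pure3_closed)
  also have "\<dots> = list_comb (tensor3 R M) (\<lambda>i. pure3 (x i) b (y i)) ts"
    using x y abc by (simp add: op23_flip_pure)
  finally show ?thesis .
qed

end


section \<open>Calculating with formal linear combinations\<close>

text \<open>Application of a sparse matrix: \<open>act i\<close> is the column of index
  \<open>i\<close>.\<close>

definition expand :: "('k, 'r) ring_scheme \<Rightarrow> ('i \<Rightarrow> ('k \<times> 'j) list) \<Rightarrow> ('k \<times> 'i) list \<Rightarrow> ('k \<times> 'j) list" where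
  "expand R act ts = concat (map (\<lambda>(c, i). map (\<lambda>(d, j). (c \<otimes>\<^bsub>R\<^esub> d, j)) (act i)) ts)"

definition coefficient :: "('k, 'r) ring_scheme \<Rightarrow> ('k \<times> 'i) list \<Rightarrow> 'i \<Rightarrow> 'k" where
  "coefficient R ts i = foldr (\<lambda>(c, j) y. if j = i then c \<oplus>\<^bsub>R\<^esub> y else y) ts \<zero>\<^bsub>R\<^esub>"

lemma expand_simps [simp]:
  "expand R act [] = []"
  "expand R act ((c, i) # ts) = map (\<lambda>(d, j). (c \<otimes>\<^bsub>R\<^esub> d, j)) (act i) @ expand R act ts"
  by (simp_all add: expand_def)

lemma coefficient_simps [simp]:
  "coefficient R [] i = \<zero>\<^bsub>R\<^esub>"
  "coefficient R ((c, j) # ts) i = (if j = i then c \<oplus>\<^bsub>R\<^esub> coefficient R ts i else coefficient R ts i)"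
  by (simp_all add: coefficient_def)

lemma (in cring) coefficient_closed: "fst ` set ts \<subseteq> carrier R \<Longrightarrow> coefficient R ts i \<in> carrier R"
  by (induction ts) auto

lemma (in cring) expand_closed:
  assumes "fst ` set ts \<subseteq> carrier R" "\<And>i. fst ` set (act i) \<subseteq> carrier R"
  shows "fst ` set (expand R act ts) \<subseteq> carrier R"
  using assms by (induction ts) (force simp: image_subset_iff)+

context module
begin

context
  fixes w :: "'i \<Rightarrow> 'c"
  assumes w: "\<And>i. w i \<in> carrier M"
begin

text \<open>Transfers an operator from vectors to coefficient lists, so that composites of operators
  become nested calls of \<open>expand\<close>.\<close>

lemma list_comb_expand:
  assumes f: "f \<in> module_hom R M M"
    and act: "\<And>i. f (w i) = list_comb M w (act i)" "\<And>i. fst ` set (act i) \<subseteq> carrier R"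
    and ts: "fst ` set ts \<subseteq> carrier R"
  shows "f (list_comb M w ts) = list_comb M w (expand R act ts)"
  using ts
proof (induction ts)
  case Nil
  show ?case
    by (simp add: module_hom_zero[OF module_axioms module_axioms f])
next
  case (Cons t ts)
  obtain c i where t: "t = (c, i)"
    by (cases t)
  have c: "c \<in> carrier R" and ts: "fst ` set ts \<subseteq> carrier R"
    using Cons.prems t by auto
  have scaled: "fst ` set (map (\<lambda>(d, j). (c \<otimes> d, j)) (act i)) \<subseteq> carrier R"
    using act(2)[of i] c by auto
  show ?case
    using Cons.IH[OF ts] c scaled
    by (simp add: t module_hom_add[OF f] module_hom_smult[OF f] w list_comb_closed[OF w ts] act(1)
        list_comb_append[OF w scaled expand_closed[OF ts act(2)]] list_comb_smult[OF w act(2)])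
qed

lemma list_comb_finsum:
  assumes ts: "fst ` set ts \<subseteq> carrier R" "snd ` set ts \<subseteq> S" and S: "finite S"
  shows "list_comb M w ts = (\<Oplus>\<^bsub>M\<^esub>i\<in>S. coefficient R ts i \<odot>\<^bsub>M\<^esub> w i)"
  using ts
proof (induction ts)
  case Nil
  show ?case
    by (simp add: w)
next
  case (Cons t ts)
  obtain c j where t: "t = (c, j)"
    by (cases t)
  have c: "c \<in> carrier R" and j: "j \<in> S" and ts: "fst ` set ts \<subseteq> carrier R" "snd ` set ts \<subseteq> S"
    using Cons.prems t by auto
  note closed = w coefficient_closed[OF ts(1)]
  \<comment> \<open>The head entry is written as a sum over \<open>S\<close> concentrated at
    \<open>j\<close>, so that it can be added to the other sum index by index.\<close>
  have "list_comb M w (t # ts) =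
      (\<Oplus>\<^bsub>M\<^esub>i\<in>S. if j = i then c \<odot>\<^bsub>M\<^esub> w i else \<zero>\<^bsub>M\<^esub>) \<oplus>\<^bsub>M\<^esub>
      (\<Oplus>\<^bsub>M\<^esub>i\<in>S. coefficient R ts i \<odot>\<^bsub>M\<^esub> w i)"
    using Cons.IH[OF ts] c by (simp add: t M.add.finprod_singleton[OF j S] w)
  also have "\<dots> = (\<Oplus>\<^bsub>M\<^esub>i\<in>S. (if j = i then c \<odot>\<^bsub>M\<^esub> w i else \<zero>\<^bsub>M\<^esub>) \<oplus>\<^bsub>M\<^esub> coefficient R ts i \<odot>\<^bsub>M\<^esub> w i)"
    using c closed by (intro M.finsum_addf[symmetric]) auto
  also have "\<dots> = (\<Oplus>\<^bsub>M\<^esub>i\<in>S. coefficient R (t # ts) i \<odot>\<^bsub>M\<^esub> w i)"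
    using c closed by (intro M.finsum_cong') (auto simp: t smult_l_distr)
  finally show ?case .
qed

text \<open>Collecting like terms gives the same sum on both sides. The family \<open>w\<close> is
  arbitrary, so this covers tensors of word values that coincide or are dependent in the
  algebra.\<close>

lemma list_comb_eqI:
  assumes ts: "fst ` set ts \<subseteq> carrier R" "snd ` set ts \<subseteq> S"
    and us: "fst ` set us \<subseteq> carrier R" "snd ` set us \<subseteq> S"
    and S: "finite S" and eq: "\<And>i. i \<in> S \<Longrightarrow> coefficient R ts i = coefficient R us i"
  shows "list_comb M w ts = list_comb M w us"
  unfolding list_comb_finsum[OF ts S] list_comb_finsum[OF us S]
  using eq w coefficient_closed[OF us(1)] by (intro M.finsum_cong') auto

end

end

section \<open>Yang-Baxter equation for words\<close>

text \<open>
  The letters stand for the tensor factors and a tuple of words for the pure tensor of the products of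
  their letters. Unlike elements of the algebra, words can be compared by computation.
\<close>

type_synonym word = "nat list"

text \<open>The form of R on a pair of words. The empty word stands for the unit, and the sign of
  the swapped term is absorbed into \<open>\<gamma>\<close>.\<close>

definition pair_terms :: "'k \<Rightarrow> 'k \<Rightarrow> 'k \<Rightarrow> word \<Rightarrow> word \<Rightarrow> ('k \<times> word \<times> word) list" where
  "pair_terms \<alpha> \<beta> \<gamma> xs ys = [(\<alpha>, [], xs @ ys), (\<beta>, xs @ ys, []), (\<gamma>, ys, xs)]"

text \<open>The form of the inverse. Multiplying in reverse order matches the swap: on b \<otimes> a
  it yields ab again, so each composite stays within three tensors.\<close>

definition S_terms :: "'k \<Rightarrow> 'k \<Rightarrow> 'k \<Rightarrow> word \<Rightarrow> word \<Rightarrow> ('k \<times> word \<times> word) list" where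
  "S_terms \<alpha> \<beta> \<gamma> xs ys = [(\<alpha>, ys @ xs, []), (\<beta>, [], ys @ xs), (\<gamma>, ys, xs)]"

definition act12 where
  "act12 f = (\<lambda>(x, y, z). map (\<lambda>(c, i). (c, fst i, snd i, z)) (f x y))"

definition act13 where
  "act13 f = (\<lambda>(x, y, z). map (\<lambda>(c, i). (c, fst i, y, snd i)) (f x z))"

definition act23 where
  "act23 f = (\<lambda>(x, y, z). map (\<lambda>(c, i). (c, x, fst i, snd i)) (f y z))"

context cring
begin

abbreviation R_terms where
  "R_terms p q u v \<equiv>
    pair_terms (p \<otimes> (u \<ominus> v)) (q \<otimes> (u \<ominus> v)) (\<ominus> (p \<otimes> u \<ominus> q \<otimes> v))"

abbreviation ybe_lhs where
  "ybe_lhs p q u v w \<equiv> expand R (act12 (R_terms p q u v)) (expand R (act13 (R_terms p q u w))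
    (expand R (act23 (R_terms p q v w)) [(\<one>, [0], [1], [2])]))"

abbreviation ybe_rhs where
  "ybe_rhs p q u v w \<equiv> expand R (act23 (R_terms p q v w)) (expand R (act13 (R_terms p q u w))
    (expand R (act12 (R_terms p q u v)) [(\<one>, [0], [1], [2])]))"

text \<open>Each side has twenty-seven terms, all labelled by these triples. Letters within a
  product are always increasing.\<close>

abbreviation ybe_keys :: "(word \<times> word \<times> word) set" where
  "ybe_keys \<equiv> {([], [], [0, 1, 2]), ([], [0, 1, 2], []), ([], [1, 2], [0]), ([], [2], [0, 1]),
    ([0, 1, 2], [], []), ([1, 2], [], [0]), ([1, 2], [0], []), ([2], [], [0, 1]),
    ([2], [0, 1], []), ([2], [1], [0])}"

lemma ybe_keys:
  "snd ` set (ybe_lhs p q u v w) \<subseteq> ybe_keys"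
  "snd ` set (ybe_rhs p q u v w) \<subseteq> ybe_keys"
  by (simp_all add: act12_def act13_def act23_def pair_terms_def)

lemma pair_terms_closed:
  "\<lbrakk>\<alpha> \<in> carrier R; \<beta> \<in> carrier R; \<gamma> \<in> carrier R\<rbrakk> \<Longrightarrow> fst ` set (pair_terms \<alpha> \<beta> \<gamma> xs ys) \<subseteq> carrier R"
  by (simp add: pair_terms_def)

lemma act_closed:
  assumes "\<And>xs ys. fst ` set (f xs ys) \<subseteq> carrier R"
  shows "fst ` set (act12 f i) \<subseteq> carrier R"
    and "fst ` set (act13 f i) \<subseteq> carrier R"
    and "fst ` set (act23 f i) \<subseteq> carrier R"
  using assms
  by (cases i; force simp: act12_def act13_def act23_def image_subset_iff)+

lemma ybe_closed:
  assumes "p \<in> carrier R" "q \<in> carrier R" "u \<in> carrier R" "v \<in> carrier R" "w \<in> carrier R"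
  shows "fst ` set (ybe_lhs p q u v w) \<subseteq> carrier R" "fst ` set (ybe_rhs p q u v w) \<subseteq> carrier R"
  using assms by (intro expand_closed act_closed pair_terms_closed; simp)+

text \<open>Proof by reflection: \<open>x\<close> and \<open>y\<close> are values of formal
  polynomials in the same variables \<open>l\<close>, and equal normal forms force equal
  values.\<close>

lemma polex_eqI:
  assumes "x = Ipolex l P" "y = Ipolex l Q" "in_carrier l" "norm P = norm Q"
  shows "x = y"
  unfolding assms(1,2) by (rule norm_eq[OF assms(3,4)])

text \<open>
  Resolution with these rules reifies a ring expression: it instantiates the schematic polynomial
  on the right-hand side.
\<close>

lemma polex_reify:
  "\<lbrakk>x = Ipolex l P; y = Ipolex l Q\<rbrakk> \<Longrightarrow> x \<oplus> y = Ipolex l (Add P Q)"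
  "\<lbrakk>x = Ipolex l P; y = Ipolex l Q\<rbrakk> \<Longrightarrow> x \<ominus> y = Ipolex l (Sub P Q)"
  "\<lbrakk>x = Ipolex l P; y = Ipolex l Q\<rbrakk> \<Longrightarrow> x \<otimes> y = Ipolex l (Mul P Q)"
  "x = Ipolex l P \<Longrightarrow> \<ominus> x = Ipolex l (Neg P)"
  "\<zero> = Ipolex l (Const 0)"
  "\<one> = Ipolex l (Const 1)"
  "x = Ipolex (x # l) (Var 0)"
  "x = Ipolex l (Var n) \<Longrightarrow> x = Ipolex (y # l) (Var (Suc n))"
  by (simp_all only: Ipolex.simps of_int_0 of_int_1 drop_0 drop_Suc_Cons head.simps)

lemmas norm_defs = sub_def mkPX_def mkPinj_def

text \<open>Some coefficients agree up to the order of their factors. Others depend on the choice of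
  pu - qv: for \<open>([], [0, 1, 2], [])\<close> both sides equal pq(q-p)v(u-w)^2, because p(u-v) -
  (pu-qv) and q(v-w) - (pv-qw) are both (q-p)v.\<close>

lemma ybe_coefficients:
  assumes "p \<in> carrier R" "q \<in> carrier R" "u \<in> carrier R" "v \<in> carrier R" "w \<in> carrier R"
    and "i \<in> ybe_keys"
  shows "coefficient R (ybe_lhs p q u v w) i = coefficient R (ybe_rhs p q u v w) i"
proof -
  have l: "in_carrier [p, q, u, v, w]"
    using assms(1-5) by (simp add: in_carrier_def)
  show ?thesis
    using assms(6)
    by (simp only: insert_iff empty_iff)
      (elim disjE FalseE; simp add: act12_def act13_def act23_def pair_terms_def del: l_one r_one;
        (rule polex_eqI[OF _ _ l], (rule polex_reify)+, simp add: norm_defs))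
qed

text \<open>
  The coefficient \<open>1 / (pu - qv)\<close> of the inverse is written as \<open>\<delta> n\<close> with \<open>n = 1 / (\<gamma> \<delta>)\<close>, so that
  the off-diagonal terms have the common factor \<open>n\<close> and vanish as polynomials.
\<close>

lemma inverse_coefficients:
  assumes "\<beta> \<in> carrier R" "\<gamma> \<in> carrier R" "\<delta> \<in> carrier R" "n \<in> carrier R"
    and n: "\<gamma> \<otimes> (\<delta> \<otimes> n) = \<one>"
  defines "\<alpha> \<equiv> \<gamma> \<oplus> \<delta> \<ominus> \<beta>"
  defines "r \<equiv> case_prod (pair_terms \<alpha> \<beta> (\<ominus> \<gamma>))"
    and "s \<equiv> case_prod (S_terms (\<alpha> \<otimes> n) (\<beta> \<otimes> n) (\<ominus> (\<delta> \<otimes> n)))"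
  shows "i \<in> {([], [0, 1]), ([0, 1], []), ([0], [1])} \<Longrightarrow>
      coefficient R (expand R s (expand R r [(\<one>, [0], [1])])) i = coefficient R [(\<one>, [0], [1])] i"
    and "i \<in> {([], [1, 0]), ([1, 0], []), ([0], [1])} \<Longrightarrow>
      coefficient R (expand R r (expand R s [(\<one>, [0], [1])])) i = coefficient R [(\<one>, [0], [1])] i"
proof -
  note defs = r_def s_def pair_terms_def S_terms_def
  have l: "in_carrier [\<beta>, \<gamma>, \<delta>, n]"
    using assms(1-4) by (simp add: in_carrier_def)
  \<comment> \<open>The diagonal coefficients, in the form in which the expansions leave them. Being
    one is not a polynomial identity, so normalisation only brings them to the left side of the
    assumption on \<open>n\<close>, which then replaces them by one.\<close>
  have "\<one> \<otimes> \<ominus> \<gamma> \<otimes> \<ominus> (\<delta> \<otimes> n) \<oplus> \<zero> = \<gamma> \<otimes> (\<delta> \<otimes> n)"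
    "\<one> \<otimes> \<ominus> (\<delta> \<otimes> n) \<otimes> \<ominus> \<gamma> \<oplus> \<zero> = \<gamma> \<otimes> (\<delta> \<otimes> n)"
    by (rule polex_eqI[OF _ _ l], (rule polex_reify)+, simp add: norm_defs)+
  note diag = this[unfolded n]
  \<comment> \<open>In both orders of composition the off-diagonal coefficients are
    n\<alpha>(\<alpha>+\<beta>-\<gamma>-\<delta>) and n\<beta>(\<alpha>+\<beta>-\<gamma>-\<delta>).
    Unfolding \<open>\<alpha>\<close> makes the bracket vanish.\<close>
  show "i \<in> {([], [0, 1]), ([0, 1], []), ([0], [1])} \<Longrightarrow>
      coefficient R (expand R s (expand R r [(\<one>, [0], [1])])) i = coefficient R [(\<one>, [0], [1])] i"
    by (simp only: insert_iff empty_iff)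
      (elim disjE FalseE; simp add: defs diag del: l_one r_one;
        (unfold \<alpha>_def, rule polex_eqI[OF _ _ l], (rule polex_reify)+, simp add: norm_defs))
  show "i \<in> {([], [1, 0]), ([1, 0], []), ([0], [1])} \<Longrightarrow>
      coefficient R (expand R r (expand R s [(\<one>, [0], [1])])) i = coefficient R [(\<one>, [0], [1])] i"
    by (simp only: insert_iff empty_iff)
      (elim disjE FalseE; simp add: defs diag del: l_one r_one;
        (unfold \<alpha>_def, rule polex_eqI[OF _ _ l], (rule polex_reify)+, simp add: norm_defs))
qed

end


section \<open>The operators of an algebra\<close>

lemma bilinear_combination:
  assumes P: "module R P" and f: "bilinear R M N P f" and g: "bilinear R M N P g"
    and h: "bilinear R M N P h" and c: "c \<in> carrier R" "d \<in> carrier R" "e \<in> carrier R"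
  shows "bilinear R M N P
    (\<lambda>m n. c \<odot>\<^bsub>P\<^esub> f m n \<oplus>\<^bsub>P\<^esub> d \<odot>\<^bsub>P\<^esub> g m n \<ominus>\<^bsub>P\<^esub> e \<odot>\<^bsub>P\<^esub> h m n)"
proof -
  interpret P: module R P by (rule P)
  \<comment> \<open>The domain \<open>Q\<close> is left open so that the same fact serves both
    arguments.\<close>
  have hom: "(\<lambda>x. c \<odot>\<^bsub>P\<^esub> f' x \<oplus>\<^bsub>P\<^esub> d \<odot>\<^bsub>P\<^esub> g' x \<ominus>\<^bsub>P\<^esub> e \<odot>\<^bsub>P\<^esub> h' x) \<in> module_hom R Q P"
    if "f' \<in> module_hom R Q P" "g' \<in> module_hom R Q P" "h' \<in> module_hom R Q P"
    for Q :: "('a, 'q, 's) module_scheme" and f' g' h'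
  proof (rule module_homI)
    note [simp] = that[THEN module_hom_apply_closed]
    show "c \<odot>\<^bsub>P\<^esub> f' x \<oplus>\<^bsub>P\<^esub> d \<odot>\<^bsub>P\<^esub> g' x \<ominus>\<^bsub>P\<^esub> e \<odot>\<^bsub>P\<^esub> h' x \<in> carrier P"
      if "x \<in> carrier Q" for x
      using that c by simp
    show "c \<odot>\<^bsub>P\<^esub> f' (x \<oplus>\<^bsub>Q\<^esub> y) \<oplus>\<^bsub>P\<^esub> d \<odot>\<^bsub>P\<^esub> g' (x \<oplus>\<^bsub>Q\<^esub> y) \<ominus>\<^bsub>P\<^esub> e \<odot>\<^bsub>P\<^esub> h' (x \<oplus>\<^bsub>Q\<^esub> y) =
        (c \<odot>\<^bsub>P\<^esub> f' x \<oplus>\<^bsub>P\<^esub> d \<odot>\<^bsub>P\<^esub> g' x \<ominus>\<^bsub>P\<^esub> e \<odot>\<^bsub>P\<^esub> h' x) \<oplus>\<^bsub>P\<^esub>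
        (c \<odot>\<^bsub>P\<^esub> f' y \<oplus>\<^bsub>P\<^esub> d \<odot>\<^bsub>P\<^esub> g' y \<ominus>\<^bsub>P\<^esub> e \<odot>\<^bsub>P\<^esub> h' y)"
      if "x \<in> carrier Q" "y \<in> carrier Q" for x y
      using that c
      by (simp add: \<open>f' \<in> _\<close>[THEN module_hom_add] \<open>g' \<in> _\<close>[THEN module_hom_add]
          \<open>h' \<in> _\<close>[THEN module_hom_add] P.smult_r_distr a_minus_def P.minus_add P.a_ac)
    show "c \<odot>\<^bsub>P\<^esub> f' (r \<odot>\<^bsub>Q\<^esub> x) \<oplus>\<^bsub>P\<^esub> d \<odot>\<^bsub>P\<^esub> g' (r \<odot>\<^bsub>Q\<^esub> x) \<ominus>\<^bsub>P\<^esub> e \<odot>\<^bsub>P\<^esub> h' (r \<odot>\<^bsub>Q\<^esub> x) =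
        r \<odot>\<^bsub>P\<^esub> (c \<odot>\<^bsub>P\<^esub> f' x \<oplus>\<^bsub>P\<^esub> d \<odot>\<^bsub>P\<^esub> g' x \<ominus>\<^bsub>P\<^esub> e \<odot>\<^bsub>P\<^esub> h' x)"
      if "r \<in> carrier R" "x \<in> carrier Q" for r x
      using that c
      by (simp add: \<open>f' \<in> _\<close>[THEN module_hom_smult] \<open>g' \<in> _\<close>[THEN module_hom_smult]
          \<open>h' \<in> _\<close>[THEN module_hom_smult] P.smult_r_distr a_minus_def P.smult_r_minus
          P.smult_assoc1[symmetric] P.R.m_comm)
  qed
  show ?thesis
    by (intro bilinearI hom bilinear_left[OF f] bilinear_left[OF g] bilinear_left[OF h]
        bilinear_right[OF f] bilinear_right[OF g] bilinear_right[OF h])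
qed

text \<open>The right side is what \<open>list_comb\<close> of a list with three entries unfolds to,
  with the minus sign moved into the scalar.\<close>

lemma combination_eq_list_form:
  assumes "module R P" "c \<in> carrier R" "d \<in> carrier R" "e \<in> carrier R"
    "x \<in> carrier P" "y \<in> carrier P" "z \<in> carrier P"
  shows "c \<odot>\<^bsub>P\<^esub> x \<oplus>\<^bsub>P\<^esub> d \<odot>\<^bsub>P\<^esub> y \<ominus>\<^bsub>P\<^esub> e \<odot>\<^bsub>P\<^esub> z =
    c \<odot>\<^bsub>P\<^esub> x \<oplus>\<^bsub>P\<^esub> (d \<odot>\<^bsub>P\<^esub> y \<oplus>\<^bsub>P\<^esub> ((\<ominus>\<^bsub>R\<^esub> e) \<odot>\<^bsub>P\<^esub> z \<oplus>\<^bsub>P\<^esub> \<zero>\<^bsub>P\<^esub>))"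
proof -
  interpret P: module R P by fact
  show ?thesis
    using assms(2-) by (simp add: a_minus_def P.smult_l_minus P.a_assoc)
qed

context fd_algebra
begin

lemma mult_bilinear: "bilinear K A A A (\<lambda>a b. a \<otimes>\<^bsub>A\<^esub> b)"
  by (intro bilinearI module_homI)
    (auto simp: A.l_distr A.r_distr smult_mult_left smult_mult_right)

lemma one_tensor_bilinear:
  "bilinear K A A A f \<Longrightarrow> bilinear K A A (tensor2 K A) (\<lambda>a b. pure2 \<one>\<^bsub>A\<^esub> (f a b))"
  by (rule bilinear_compose_hom[OF _ bilinear_right[OF pure2_bilinear A.one_closed]])

lemma tensor_one_bilinear:
  "bilinear K A A A f \<Longrightarrow> bilinear K A A (tensor2 K A) (\<lambda>a b. pure2 (f a b) \<one>\<^bsub>A\<^esub>)"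
  by (rule bilinear_compose_hom[OF _ bilinear_left[OF pure2_bilinear A.one_closed]])

text \<open>The candidate inverse with its coefficients left free, so that bilinearity is settled
  before any scalar is inverted.\<close>

definition algebra_S where
  "algebra_S c d e =
    (let T = tensor2 K A in
      tensor_lift K A A T (\<lambda>a b.
        c \<odot>\<^bsub>T\<^esub> pure2 (b \<otimes>\<^bsub>A\<^esub> a) \<one>\<^bsub>A\<^esub> \<oplus>\<^bsub>T\<^esub> d \<odot>\<^bsub>T\<^esub> pure2 \<one>\<^bsub>A\<^esub> (b \<otimes>\<^bsub>A\<^esub> a)
        \<ominus>\<^bsub>T\<^esub> e \<odot>\<^bsub>T\<^esub> pure2 b a))"

context
  fixes c d e
  assumes cde: "c \<in> carrier K" "d \<in> carrier K" "e \<in> carrier K"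
begin

lemma algebra_S_bilinear:
  "bilinear K A A (tensor2 K A) (\<lambda>a b.
    c \<odot>\<^bsub>tensor2 K A\<^esub> pure2 (b \<otimes>\<^bsub>A\<^esub> a) \<one>\<^bsub>A\<^esub>
    \<oplus>\<^bsub>tensor2 K A\<^esub> d \<odot>\<^bsub>tensor2 K A\<^esub> pure2 \<one>\<^bsub>A\<^esub> (b \<otimes>\<^bsub>A\<^esub> a)
    \<ominus>\<^bsub>tensor2 K A\<^esub> e \<odot>\<^bsub>tensor2 K A\<^esub> pure2 b a)"
  by (rule bilinear_combination[OF tensor2_is_module tensor_one_bilinear[OF bilinear_flip[OF mult_bilinear]]
        one_tensor_bilinear[OF bilinear_flip[OF mult_bilinear]] bilinear_flip[OF pure2_bilinear] cde])

lemma algebra_S_hom: "algebra_S c d e \<in> module_hom K (tensor2 K A) (tensor2 K A)"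
  unfolding algebra_S_def Let_def by (rule tensor2_lift_hom[OF tensor2_is_module algebra_S_bilinear])

lemma algebra_S_pure:
  assumes "a \<in> carrier A" "b \<in> carrier A"
  shows "algebra_S c d e (pure2 a b) =
    c \<odot>\<^bsub>tensor2 K A\<^esub> pure2 (b \<otimes>\<^bsub>A\<^esub> a) \<one>\<^bsub>A\<^esub>
    \<oplus>\<^bsub>tensor2 K A\<^esub> d \<odot>\<^bsub>tensor2 K A\<^esub> pure2 \<one>\<^bsub>A\<^esub> (b \<otimes>\<^bsub>A\<^esub> a)
    \<ominus>\<^bsub>tensor2 K A\<^esub> e \<odot>\<^bsub>tensor2 K A\<^esub> pure2 b a"
  unfolding algebra_S_def Let_def
  by (rule tensor2_lift_pure[OF tensor2_is_module algebra_S_bilinear assms])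

end

context
  fixes p q u v
  assumes pquv: "p \<in> carrier K" "q \<in> carrier K" "u \<in> carrier K" "v \<in> carrier K"
begin

lemma algebra_R_bilinear:
  "bilinear K A A (tensor2 K A) (\<lambda>a b.
    (p \<otimes> (u \<ominus> v)) \<odot>\<^bsub>tensor2 K A\<^esub> pure2 \<one>\<^bsub>A\<^esub> (a \<otimes>\<^bsub>A\<^esub> b)
    \<oplus>\<^bsub>tensor2 K A\<^esub> (q \<otimes> (u \<ominus> v)) \<odot>\<^bsub>tensor2 K A\<^esub> pure2 (a \<otimes>\<^bsub>A\<^esub> b) \<one>\<^bsub>A\<^esub>
    \<ominus>\<^bsub>tensor2 K A\<^esub> (p \<otimes> u \<ominus> q \<otimes> v) \<odot>\<^bsub>tensor2 K A\<^esub> pure2 b a)"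
  using pquv
  by (intro bilinear_combination[OF tensor2_is_module one_tensor_bilinear tensor_one_bilinear]
    mult_bilinear bilinear_flip[OF pure2_bilinear]) auto

lemma algebra_R_hom: "algebra_R K A p q u v \<in> module_hom K (tensor2 K A) (tensor2 K A)"
  unfolding algebra_R_def Let_def by (rule tensor2_lift_hom[OF tensor2_is_module algebra_R_bilinear])

lemma algebra_R_pure:
  assumes "a \<in> carrier A" "b \<in> carrier A"
  shows "algebra_R K A p q u v (pure2 a b) =
    (p \<otimes> (u \<ominus> v)) \<odot>\<^bsub>tensor2 K A\<^esub> pure2 \<one>\<^bsub>A\<^esub> (a \<otimes>\<^bsub>A\<^esub> b)
    \<oplus>\<^bsub>tensor2 K A\<^esub> (q \<otimes> (u \<ominus> v)) \<odot>\<^bsub>tensor2 K A\<^esub> pure2 (a \<otimes>\<^bsub>A\<^esub> b) \<one>\<^bsub>A\<^esub>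
    \<ominus>\<^bsub>tensor2 K A\<^esub> (p \<otimes> u \<ominus> q \<otimes> v) \<odot>\<^bsub>tensor2 K A\<^esub> pure2 b a"
  unfolding algebra_R_def Let_def
  by (rule tensor2_lift_pure[OF tensor2_is_module algebra_R_bilinear assms])

end

section \<open>Evaluation of words in the algebra\<close>

definition word_value :: "(nat \<Rightarrow> 'c) \<Rightarrow> word \<Rightarrow> 'c" where
  "word_value env xs = foldr (\<lambda>i y. env i \<otimes>\<^bsub>A\<^esub> y) xs \<one>\<^bsub>A\<^esub>"

lemma word_value_simps [simp]:
  "word_value env [] = \<one>\<^bsub>A\<^esub>"
  "word_value env (i # xs) = env i \<otimes>\<^bsub>A\<^esub> word_value env xs"
  by (simp_all add: word_value_def)

context
  fixes env :: "nat \<Rightarrow> 'c"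
  assumes env: "\<And>i. env i \<in> carrier A"
begin

lemma word_value_closed: "word_value env xs \<in> carrier A"
  by (induction xs) (auto simp: env)

lemma word_value_append: "word_value env (xs @ ys) = word_value env xs \<otimes>\<^bsub>A\<^esub> word_value env ys"
  by (induction xs) (auto simp: env word_value_closed A.m_assoc)

abbreviation word2 where
  "word2 \<equiv> \<lambda>(xs, ys). pure2 (word_value env xs) (word_value env ys)"

abbreviation word3 where
  "word3 \<equiv> \<lambda>(xs, ys, zs). pure3 (word_value env xs) (word_value env ys) (word_value env zs)"

lemma word2_closed: "word2 i \<in> carrier (tensor2 K A)"
  by (cases i) (simp add: pure2_closed word_value_closed)

lemma word3_closed: "word3 i \<in> carrier (tensor3 K A)"
  by (cases i) (simp add: pure3_closed word_value_closed)

lemma algebra_S_word: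
  assumes "c \<in> carrier K" "d \<in> carrier K" "e \<in> carrier K"
  shows "algebra_S c d e (word2 i) = list_comb (tensor2 K A) word2 (case_prod (S_terms c d (\<ominus> e)) i)"
  using assms
  by (cases i) (simp add: algebra_S_pure word_value_closed word_value_append S_terms_def
      combination_eq_list_form[OF tensor2_is_module] pure2_closed)

context
  fixes p q
  assumes pq: "p \<in> carrier K" "q \<in> carrier K"
begin

context
  fixes u v
  assumes uv: "u \<in> carrier K" "v \<in> carrier K"
begin

text \<open>Stated with \<open>fst\<close> and \<open>snd\<close> instead of \<open>word2\<close>,
  to serve as the expansion hypothesis of \<open>op12_pure\<close>, \<open>op13_pure\<close> and
  \<open>op23_pure\<close>.\<close>

lemma algebra_R_word:
  "algebra_R K A p q u v (pure2 (word_value env xs) (word_value env ys)) =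
    list_comb (tensor2 K A) (\<lambda>i. pure2 (word_value env (fst i)) (word_value env (snd i))) (R_terms p q u v xs ys)"
  using pq uv
  by (simp add: algebra_R_pure word_value_closed word_value_append pair_terms_def
      combination_eq_list_form[OF tensor2_is_module] pure2_closed)

lemma R_terms_closed: "fst ` set (R_terms p q u v xs ys) \<subseteq> carrier K"
  using pq uv by (intro pair_terms_closed) auto

lemma algebra_R_act:
  "op12 K A (algebra_R K A p q u v) (word3 i) = list_comb (tensor3 K A) word3 (act12 (R_terms p q u v) i)"
  "op13 K A (algebra_R K A p q u v) (word3 i) = list_comb (tensor3 K A) word3 (act13 (R_terms p q u v) i)"
  "op23 K A (algebra_R K A p q u v) (word3 i) = list_comb (tensor3 K A) word3 (act23 (R_terms p q u v) i)"
proof -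
  obtain xs ys zs where i: "i = (xs, ys, zs)"
    by (cases i)
  note facts = algebra_R_hom[OF pq uv] word_value_closed word_value_closed R_terms_closed
    word_value_closed word_value_closed word_value_closed algebra_R_word
  show "op12 K A (algebra_R K A p q u v) (word3 i) = list_comb (tensor3 K A) word3 (act12 (R_terms p q u v) i)"
    unfolding i act12_def prod.case list_comb_reindex by (rule op12_pure[OF facts])
  show "op13 K A (algebra_R K A p q u v) (word3 i) = list_comb (tensor3 K A) word3 (act13 (R_terms p q u v) i)"
    unfolding i act13_def prod.case list_comb_reindex by (rule op13_pure[OF facts])
  show "op23 K A (algebra_R K A p q u v) (word3 i) = list_comb (tensor3 K A) word3 (act23 (R_terms p q u v) i)"
    unfolding i act23_def prod.case list_comb_reindex by (rule op23_pure[OF facts])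
qed

lemma algebra_R_expand:
  assumes ts: "fst ` set ts \<subseteq> carrier K"
  shows "op12 K A (algebra_R K A p q u v) (list_comb (tensor3 K A) word3 ts) =
      list_comb (tensor3 K A) word3 (expand K (act12 (R_terms p q u v)) ts)"
    and "op13 K A (algebra_R K A p q u v) (list_comb (tensor3 K A) word3 ts) =
      list_comb (tensor3 K A) word3 (expand K (act13 (R_terms p q u v)) ts)"
    and "op23 K A (algebra_R K A p q u v) (list_comb (tensor3 K A) word3 ts) =
      list_comb (tensor3 K A) word3 (expand K (act23 (R_terms p q u v)) ts)"
proof -
  interpret T3: module K "tensor3 K A" by (rule tensor3_is_module)
  note hom = algebra_R_hom[OF pq uv]
  show "op12 K A (algebra_R K A p q u v) (list_comb (tensor3 K A) word3 ts) =
      list_comb (tensor3 K A) word3 (expand K (act12 (R_terms p q u v)) ts)"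
    using ts by (intro T3.list_comb_expand op12_hom hom word3_closed algebra_R_act act_closed R_terms_closed)
  show "op13 K A (algebra_R K A p q u v) (list_comb (tensor3 K A) word3 ts) =
      list_comb (tensor3 K A) word3 (expand K (act13 (R_terms p q u v)) ts)"
    using ts by (intro T3.list_comb_expand op13_hom hom word3_closed algebra_R_act act_closed R_terms_closed)
  show "op23 K A (algebra_R K A p q u v) (list_comb (tensor3 K A) word3 ts) =
      list_comb (tensor3 K A) word3 (expand K (act23 (R_terms p q u v)) ts)"
    using ts by (intro T3.list_comb_expand op23_hom hom word3_closed algebra_R_act act_closed R_terms_closed)
qed

lemma R_expand_closed:
  assumes "fst ` set ts \<subseteq> carrier K"
  shows "fst ` set (expand K (act12 (R_terms p q u v)) ts) \<subseteq> carrier K"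
    and "fst ` set (expand K (act13 (R_terms p q u v)) ts) \<subseteq> carrier K"
    and "fst ` set (expand K (act23 (R_terms p q u v)) ts) \<subseteq> carrier K"
  using assms by (intro expand_closed act_closed R_terms_closed; assumption)+

end

text \<open>Starting from one triple of single letters, both composites become evaluations of
  \<open>ybe_lhs\<close> and \<open>ybe_rhs\<close>. The letters take arbitrary values through
  \<open>env\<close>.\<close>

lemma algebra_R_YB_word:
  assumes "u \<in> carrier K" "v \<in> carrier K" "w \<in> carrier K"
  shows "op12 K A (algebra_R K A p q u v) (op13 K A (algebra_R K A p q u w)
      (op23 K A (algebra_R K A p q v w) (word3 ([0], [1], [2])))) =
    op23 K A (algebra_R K A p q v w) (op13 K A (algebra_R K A p q u w)
      (op12 K A (algebra_R K A p q u v) (word3 ([0], [1], [2]))))"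
    (is "?l = ?r")
proof -
  interpret T3: module K "tensor3 K A" by (rule tensor3_is_module)
  let ?s = "[(\<one>, [0], [1], [2])] :: ('a \<times> word \<times> word \<times> word) list"
  have start: "word3 ([0], [1], [2]) = list_comb (tensor3 K A) word3 ?s"
    using word3_closed[of "([0], [1], [2])"] by simp
  have start_closed: "fst ` set ?s \<subseteq> carrier K"
    by simp
  have "?l = list_comb (tensor3 K A) word3 (ybe_lhs p q u v w)"
    unfolding start using assms by (simp only: algebra_R_expand R_expand_closed start_closed)
  also have "\<dots> = list_comb (tensor3 K A) word3 (ybe_rhs p q u v w)"
    using ybe_closed[OF pq assms] ybe_keys ybe_coefficients[OF pq assms]
    by (intro T3.list_comb_eqI[where S = ybe_keys] word3_closed) auto
  also have "\<dots> = ?r"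
    unfolding start using assms by (simp only: algebra_R_expand R_expand_closed start_closed)
  finally show ?thesis .
qed

end

end

section \<open>The Yang-Baxter equation and the inverse\<close>

lemma algebra_R_coloured_YB:
  assumes pq: "p \<in> carrier K" "q \<in> carrier K" and X: "X \<subseteq> carrier K"
  shows "coloured_YB_operator K A X (algebra_R K A p q)"
  unfolding coloured_YB_operator_def
proof (intro conjI ballI)
  show "vectorspace K A"
    by (rule vectorspace_axioms)
  show "vectorspace.fin_dim K A"
    by (rule finite_dimensional)
  show "algebra_R K A p q u v \<in> module_hom K (tensor2 K A) (tensor2 K A)" if "u \<in> X" "v \<in> X" for u v
    using algebra_R_hom pq X that by blast
  fix u v w x
  assume "u \<in> X" "v \<in> X" "w \<in> X" and x: "x \<in> carrier (tensor3 K A)"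
  then have uvw: "u \<in> carrier K" "v \<in> carrier K" "w \<in> carrier K"
    using X by auto
  let ?l = "\<lambda>x. op12 K A (algebra_R K A p q u v) (op13 K A (algebra_R K A p q u w)
    (op23 K A (algebra_R K A p q v w) x))"
  let ?r = "\<lambda>x. op23 K A (algebra_R K A p q v w) (op13 K A (algebra_R K A p q u w)
    (op12 K A (algebra_R K A p q u v) x))"
  have "?l x = ?r x"
  proof (rule tensor3_hom_eqI[OF tensor3_is_module _ _ _ x])
    show "?l \<in> module_hom K (tensor3 K A) (tensor3 K A)" "?r \<in> module_hom K (tensor3 K A) (tensor3 K A)"
      using pq uvw
      by (intro module_hom_comp[OF op12_hom] module_hom_comp[OF op13_hom] module_hom_comp[OF op23_hom]
          op12_hom op23_hom algebra_R_hom; simp)+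
    fix a b c
    assume abc: "a \<in> carrier A" "b \<in> carrier A" "c \<in> carrier A"
    \<comment> \<open>Letters 0, 1, 2 stand for \<open>a\<close>, \<open>b\<close>,
      \<open>c\<close>. Later letters also go to \<open>c\<close>, which keeps every value in the
      carrier.\<close>
    define env where "env = (\<lambda>i::nat. if i = 0 then a else if i = 1 then b else c)"
    have env: "env i \<in> carrier A" for i
      using abc by (simp add: env_def)
    have "word3 env ([0], [1], [2]) = pure3 a b c"
      using abc by (simp add: env_def)
    then show "?l (pure3 a b c) = ?r (pure3 a b c)"
      using algebra_R_YB_word[of env, OF env pq uvw] by (simp only:)
  qed
  then show "(op12 K A (algebra_R K A p q u v) \<circ> op13 K A (algebra_R K A p q u w) \<circ>
      op23 K A (algebra_R K A p q v w)) x =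
    (op23 K A (algebra_R K A p q v w) \<circ> op13 K A (algebra_R K A p q u w) \<circ>
      op12 K A (algebra_R K A p q u v)) x"
    by simp
qed

lemma algebra_R_inverse:
  assumes pq: "p \<in> carrier K" "q \<in> carrier K" and uv: "u \<in> carrier K" "v \<in> carrier K"
    and ne: "p \<otimes> u \<noteq> q \<otimes> v" "q \<otimes> u \<noteq> p \<otimes> v"
  defines "n \<equiv> inv ((q \<otimes> u \<ominus> p \<otimes> v) \<otimes> (p \<otimes> u \<ominus> q \<otimes> v))"
  shows "inverse_operator K (tensor2 K A) (algebra_R K A p q u v)
    (algebra_S (p \<otimes> (u \<ominus> v) \<otimes> n) (q \<otimes> (u \<ominus> v) \<otimes> n) (inv (p \<otimes> u \<ominus> q \<otimes> v)))"
proof -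
  define \<gamma> where "\<gamma> = p \<otimes> u \<ominus> q \<otimes> v"
  define \<delta> where "\<delta> = q \<otimes> u \<ominus> p \<otimes> v"
  define \<alpha> where "\<alpha> = p \<otimes> (u \<ominus> v)"
  define \<beta> where "\<beta> = q \<otimes> (u \<ominus> v)"
  \<comment> \<open>The statement has the inverse of \<open>\<gamma>\<close> here; \<open>e\<close>
    is the same scalar in the form that \<open>inverse_coefficients\<close> uses.\<close>
  define e where "e = \<delta> \<otimes> n"
  note defs = \<gamma>_def \<delta>_def \<alpha>_def \<beta>_def
  have "\<gamma> \<noteq> \<zero>" "\<delta> \<noteq> \<zero>"
    using pq uv ne by (simp_all add: eq_diff0 defs)
  moreover have greek: "\<alpha> \<in> carrier K" "\<beta> \<in> carrier K" "\<gamma> \<in> carrier K" "\<delta> \<in> carrier K"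
    using pq uv by (simp_all add: defs)
  ultimately have "\<delta> \<otimes> \<gamma> \<in> Units K"
    by (intro Units_m_closed) (simp_all add: field_Units)
  then have n: "n \<in> carrier K" "\<delta> \<otimes> \<gamma> \<otimes> n = \<one>"
    unfolding n_def \<gamma>_def[symmetric] \<delta>_def[symmetric] by simp_all
  have \<gamma>: "\<gamma> \<otimes> (\<delta> \<otimes> n) = \<one>"
    using n greek by (simp add: m_ac)
  then have inv: "inv \<gamma> = e"
    unfolding e_def using greek n by (intro comm_inv_char) auto
  have l: "in_carrier [p, q, u, v]"
    using pq uv by (simp add: in_carrier_def)
  \<comment> \<open>Matches the actual coefficient with the \<open>\<alpha>\<close> of
    \<open>inverse_coefficients\<close>, which is given there through the other three.\<close>
  have sum: "\<alpha> = \<gamma> \<oplus> \<delta> \<ominus> \<beta>"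
    unfolding defs by (rule polex_eqI[OF _ _ l], (rule polex_reify)+, simp add: norm_defs)
  interpret T2: module K "tensor2 K A" by (rule tensor2_is_module)
  let ?S = "algebra_S (\<alpha> \<otimes> n) (\<beta> \<otimes> n) e"
  let ?R = "algebra_R K A p q u v"
  have S_closed: "\<alpha> \<otimes> n \<in> carrier K" "\<beta> \<otimes> n \<in> carrier K" "e \<in> carrier K"
    using greek n by (simp_all add: e_def)
  have R: "?R \<in> module_hom K (tensor2 K A) (tensor2 K A)"
    using pq uv by (rule algebra_R_hom)
  have S: "?S \<in> module_hom K (tensor2 K A) (tensor2 K A)"
    using S_closed by (intro algebra_S_hom)
  let ?r = "case_prod (pair_terms \<alpha> \<beta> (\<ominus> \<gamma>))"
  let ?s = "case_prod (S_terms (\<alpha> \<otimes> n) (\<beta> \<otimes> n) (\<ominus> e))"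
  let ?t = "[(\<one>, [0], [1])] :: ('a \<times> word \<times> word) list"
  have r_closed: "fst ` set (?r i) \<subseteq> carrier K" for i
    using greek by (cases i) (simp add: pair_terms_def)
  have s_closed: "fst ` set (?s i) \<subseteq> carrier K" for i
    using S_closed by (cases i) (simp add: S_terms_def)
  have pure: "?S (?R (pure2 a b)) = pure2 a b" "?R (?S (pure2 a b)) = pure2 a b"
    if ab: "a \<in> carrier A" "b \<in> carrier A" for a b
  proof -
    define env where "env = (\<lambda>i::nat. if i = 0 then a else b)"
    have env: "env i \<in> carrier A" for i
      using ab by (simp add: env_def)
    note w2 = word2_closed[of env, OF env]
    have start: "pure2 a b = list_comb (tensor2 K A) (word2 env) ?t"
      using ab by (simp add: env_def pure2_closed)
    have act_r: "?R (word2 env i) = list_comb (tensor2 K A) (word2 env) (?r i)" for i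
      using algebra_R_word[of env, OF env pq uv] by (simp add: defs case_prod_unfold)
    have act_s: "?S (word2 env i) = list_comb (tensor2 K A) (word2 env) (?s i)" for i
      using S_closed by (intro algebra_S_word env)
    note exp_r = T2.list_comb_expand[of "word2 env", OF w2 R act_r r_closed]
    note exp_s = T2.list_comb_expand[of "word2 env", OF w2 S act_s s_closed]
    have t_closed: "fst ` set ?t \<subseteq> carrier K"
      by simp
    have "?S (?R (pure2 a b)) = list_comb (tensor2 K A) (word2 env) (expand K ?s (expand K ?r ?t))"
      unfolding start by (simp only: exp_r exp_s t_closed expand_closed r_closed)
    also have "\<dots> = list_comb (tensor2 K A) (word2 env) ?t"
    proof (rule T2.list_comb_eqI[where S = "{([], [0, 1]), ([0, 1], []), ([0], [1])}", OF w2 _ _ t_closed])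
      show "fst ` set (expand K ?s (expand K ?r ?t)) \<subseteq> carrier K"
        by (intro expand_closed t_closed r_closed s_closed)
      show "snd ` set (expand K ?s (expand K ?r ?t)) \<subseteq> {([], [0, 1]), ([0, 1], []), ([0], [1])}"
        by (simp add: pair_terms_def S_terms_def)
    qed (simp, simp, rule inverse_coefficients(1)[OF greek(2-4) n(1) \<gamma>, folded sum e_def])
    finally show "?S (?R (pure2 a b)) = pure2 a b"
      by (simp only: start)
    have "?R (?S (pure2 a b)) = list_comb (tensor2 K A) (word2 env) (expand K ?r (expand K ?s ?t))"
      unfolding start by (simp only: exp_r exp_s t_closed expand_closed s_closed)
    also have "\<dots> = list_comb (tensor2 K A) (word2 env) ?t"
    proof (rule T2.list_comb_eqI[where S = "{([], [1, 0]), ([1, 0], []), ([0], [1])}", OF w2 _ _ t_closed])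
      show "fst ` set (expand K ?r (expand K ?s ?t)) \<subseteq> carrier K"
        by (intro expand_closed t_closed r_closed s_closed)
      show "snd ` set (expand K ?r (expand K ?s ?t)) \<subseteq> {([], [1, 0]), ([1, 0], []), ([0], [1])}"
        by (simp add: pair_terms_def S_terms_def)
    qed (simp, simp, rule inverse_coefficients(2)[OF greek(2-4) n(1) \<gamma>, folded sum e_def])
    finally show "?R (?S (pure2 a b)) = pure2 a b"
      by (simp only: start)
  qed
  note hom_eqI = module_pair.hom_eqI[OF module_pair_self tensor2_is_module, folded tensor2_def]
  have "inverse_operator K (tensor2 K A) ?R ?S"
    unfolding inverse_operator_def
    using R S hom_eqI[OF module_hom_comp[OF R S] module_hom_id pure(1)]
      hom_eqI[OF module_hom_comp[OF S R] module_hom_id pure(2)] by blast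
  then show ?thesis
    by (simp only: defs inv[symmetric])
qed

end

theorem theorem2p1:
  fixes K :: "('k, 'r) ring_scheme" (structure)
    and A :: "('k, 'a, 'x) module_scheme"
    and X :: "'k set"
  assumes "fd_algebra K A"
    and "X \<subseteq> carrier K"
  shows "let T = tensor2 K A in
    (\<forall>p\<in>carrier K. \<forall>q\<in>carrier K.
      coloured_YB_operator K A X (algebra_R K A p q) \<and>
      (\<forall>u\<in>X. \<forall>v\<in>X. \<forall>a\<in>carrier A. \<forall>b\<in>carrier A.
        algebra_R K A p q u v (a \<boxtimes>\<^bsub>K,A\<^esub> b) =
          (p \<otimes> (u \<ominus> v)) \<odot>\<^bsub>T\<^esub> (\<one>\<^bsub>A\<^esub> \<boxtimes>\<^bsub>K,A\<^esub> (a \<otimes>\<^bsub>A\<^esub> b))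
          \<oplus>\<^bsub>T\<^esub> (q \<otimes> (u \<ominus> v)) \<odot>\<^bsub>T\<^esub> ((a \<otimes>\<^bsub>A\<^esub> b) \<boxtimes>\<^bsub>K,A\<^esub> \<one>\<^bsub>A\<^esub>)
          \<ominus>\<^bsub>T\<^esub> (p \<otimes> u \<ominus> q \<otimes> v) \<odot>\<^bsub>T\<^esub> (b \<boxtimes>\<^bsub>K,A\<^esub> a))) \<and>
    (\<forall>p\<in>carrier K. \<forall>q\<in>carrier K. \<forall>u\<in>X. \<forall>v\<in>X.
      p \<otimes> u \<noteq> q \<otimes> v \<longrightarrow> q \<otimes> u \<noteq> p \<otimes> v \<longrightarrow>
      (\<exists>S. inverse_operator K T (algebra_R K A p q u v) S \<and>
        (\<forall>a\<in>carrier A. \<forall>b\<in>carrier A.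
          S (a \<boxtimes>\<^bsub>K,A\<^esub> b) =
            (p \<otimes> (u \<ominus> v) \<otimes> inv ((q \<otimes> u \<ominus> p \<otimes> v) \<otimes> (p \<otimes> u \<ominus> q \<otimes> v)))
              \<odot>\<^bsub>T\<^esub> ((b \<otimes>\<^bsub>A\<^esub> a) \<boxtimes>\<^bsub>K,A\<^esub> \<one>\<^bsub>A\<^esub>)
            \<oplus>\<^bsub>T\<^esub> (q \<otimes> (u \<ominus> v) \<otimes> inv ((q \<otimes> u \<ominus> p \<otimes> v) \<otimes> (p \<otimes> u \<ominus> q \<otimes> v)))
              \<odot>\<^bsub>T\<^esub> (\<one>\<^bsub>A\<^esub> \<boxtimes>\<^bsub>K,A\<^esub> (b \<otimes>\<^bsub>A\<^esub> a))
            \<ominus>\<^bsub>T\<^esub> inv (p \<otimes> u \<ominus> q \<otimes> v) \<odot>\<^bsub>T\<^esub> (b \<boxtimes>\<^bsub>K,A\<^esub> a))))"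
proof -
  interpret fd_algebra K A by fact
  show ?thesis
    unfolding Let_def
  proof (intro conjI ballI impI)
    fix p q
    assume pq: "p \<in> carrier K" "q \<in> carrier K"
    show "coloured_YB_operator K A X (algebra_R K A p q)"
      by (rule algebra_R_coloured_YB[OF pq assms(2)])
    fix u v
    assume "u \<in> X" "v \<in> X"
    then have uv: "u \<in> carrier K" "v \<in> carrier K"
      using assms(2) by auto
    note R_pure = algebra_R_pure[OF pq uv]
    show "algebra_R K A p q u v (a \<boxtimes>\<^bsub>K,A\<^esub> b) =
          (p \<otimes> (u \<ominus> v)) \<odot>\<^bsub>tensor2 K A\<^esub> (\<one>\<^bsub>A\<^esub> \<boxtimes>\<^bsub>K,A\<^esub> (a \<otimes>\<^bsub>A\<^esub> b))
          \<oplus>\<^bsub>tensor2 K A\<^esub> (q \<otimes> (u \<ominus> v)) \<odot>\<^bsub>tensor2 K A\<^esub> ((a \<otimes>\<^bsub>A\<^esub> b) \<boxtimes>\<^bsub>K,A\<^esub> \<one>\<^bsub>A\<^esub>)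
          \<ominus>\<^bsub>tensor2 K A\<^esub> (p \<otimes> u \<ominus> q \<otimes> v) \<odot>\<^bsub>tensor2 K A\<^esub> (b \<boxtimes>\<^bsub>K,A\<^esub> a)"
      if "a \<in> carrier A" "b \<in> carrier A" for a b
      by (rule R_pure[OF that])
    assume ne: "p \<otimes> u \<noteq> q \<otimes> v" "q \<otimes> u \<noteq> p \<otimes> v"
    have "q \<otimes> u \<ominus> p \<otimes> v \<in> Units K" "p \<otimes> u \<ominus> q \<otimes> v \<in> Units K"
      using pq uv ne by (simp_all add: field_Units eq_diff0)
    then have inv: "inv ((q \<otimes> u \<ominus> p \<otimes> v) \<otimes> (p \<otimes> u \<ominus> q \<otimes> v)) \<in> carrier K"
      "inv (p \<otimes> u \<ominus> q \<otimes> v) \<in> carrier K"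
      by (auto intro: Units_m_closed)
    note S_pure = algebra_S_pure[OF _ _ inv(2)]
    show "\<exists>S. inverse_operator K (tensor2 K A) (algebra_R K A p q u v) S \<and>
        (\<forall>a\<in>carrier A. \<forall>b\<in>carrier A.
          S (a \<boxtimes>\<^bsub>K,A\<^esub> b) =
            (p \<otimes> (u \<ominus> v) \<otimes> inv ((q \<otimes> u \<ominus> p \<otimes> v) \<otimes> (p \<otimes> u \<ominus> q \<otimes> v)))
              \<odot>\<^bsub>tensor2 K A\<^esub> ((b \<otimes>\<^bsub>A\<^esub> a) \<boxtimes>\<^bsub>K,A\<^esub> \<one>\<^bsub>A\<^esub>)
            \<oplus>\<^bsub>tensor2 K A\<^esub> (q \<otimes> (u \<ominus> v) \<otimes> inv ((q \<otimes> u \<ominus> p \<otimes> v) \<otimes> (p \<otimes> u \<ominus> q \<otimes> v)))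
              \<odot>\<^bsub>tensor2 K A\<^esub> (\<one>\<^bsub>A\<^esub> \<boxtimes>\<^bsub>K,A\<^esub> (b \<otimes>\<^bsub>A\<^esub> a))
            \<ominus>\<^bsub>tensor2 K A\<^esub> inv (p \<otimes> u \<ominus> q \<otimes> v) \<odot>\<^bsub>tensor2 K A\<^esub> (b \<boxtimes>\<^bsub>K,A\<^esub> a))"
      \<comment> \<open>Unification with \<open>algebra_R_inverse\<close> supplies the witness,
        \<open>algebra_S\<close> with the displayed coefficients.\<close>
      by (rule exI, rule conjI[OF algebra_R_inverse[OF pq uv ne]], intro ballI S_pure)
        (use pq uv inv in simp_all)
  qed
qed

end
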